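(* For $j\geqslant1$ let $$d(j)=\begin{cases}\Phi^{-1}(\{j\sqrt2\}),&\text{if }|\Phi^{-1}(\{j\sqrt2\})|\leqslant\log j,\\0,&\text{otherwise,}\end{cases}$$ and let $h_n:S_n\to\mathbb R$ be the additive function $h_n(\sigma)=\sum_{j=1}^n\hat h_n(j)\alpha_j(\sigma)$ with $\hat h_n(j)=d(j)(j/n)^{1/2}$. Let $F_n(x)=\nu_n(h_n(\sigma)<x)$, where $\nu_n$ is the uniform probability measure on $S_n$. Then there exists a constant $c>0$ such that $$\sup_{x\in\mathbb R}|F_n(x)-\Phi(x)|\ll\frac1{n^c}.$$
   Context: $\Phi$ is the standard normal distribution function, $\Phi^{-1}$ its inverse, $\{y\}$ the fractional part of $y$. $\alpha_j(\sigma)$ is the number of cycles of length $j$ in the disjoint cycle decomposition of $\sigma\in S_n$. *)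

theory Defs
  imports "HOL-Probability.Probability" "HOL-Combinatorics.Orbits"
begin

definition Phi :: "real \<Rightarrow> real" where
  "Phi = cdf std_normal_distribution"

text \<open>
  \<open>Phi\<close> is injective with range \<open>{0<..<1}\<close>, so \<open>inv Phi p\<close> is unspecified only for
  \<open>p \<le> 0\<close> or \<open>p \<ge> 1\<close>.  It is only applied to fractional parts of \<open>j * sqrt 2\<close> with \<open>j \<ge> 1\<close>,
  which lie strictly between 0 and 1 because \<open>sqrt 2\<close> is irrational.
\<close>
definition Phi_inv :: "real \<Rightarrow> real" where
  "Phi_inv = inv Phi"

definition d :: "nat \<Rightarrow> real" where
  "d j = (if \<bar>Phi_inv (frac (real j * sqrt 2))\<bar> \<le> ln (real j)
          then Phi_inv (frac (real j * sqrt 2)) else 0)"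

text \<open>Elements of \<open>Sym n\<close> are the identity outside \<open>{1..n}\<close>.\<close>
definition Sym :: "nat \<Rightarrow> (nat \<Rightarrow> nat) set" where
  "Sym n = {\<sigma>. \<sigma> permutes {1..n}}"

text \<open>
  A cycle is identified with the set of points it moves around; fixed points in \<open>{1..n}\<close> count as
  cycles of length 1.  The restriction to subsets of \<open>{1..n}\<close> is needed because \<open>\<sigma>\<close>
  also fixes every natural number outside \<open>{1..n}\<close>.
\<close>
definition cycle_count :: "nat \<Rightarrow> nat \<Rightarrow> (nat \<Rightarrow> nat) \<Rightarrow> nat" where
  "cycle_count n j \<sigma> = card {C. C \<subseteq> {1..n} \<and> cyclic_on \<sigma> C \<and> card C = j}"

definition h_hat :: "nat \<Rightarrow> nat \<Rightarrow> real" where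
  "h_hat n j = d j * sqrt (real j / real n)"

definition h :: "nat \<Rightarrow> (nat \<Rightarrow> nat) \<Rightarrow> real" where
  "h n \<sigma> = (\<Sum>j=1..n. h_hat n j * real (cycle_count n j \<sigma>))"

definition \<nu> :: "nat \<Rightarrow> (nat \<Rightarrow> nat) pmf" where
  "\<nu> n = pmf_of_set (Sym n)"

definition F :: "nat \<Rightarrow> real \<Rightarrow> real" where
  "F n x = measure_pmf.prob (\<nu> n) {\<sigma>. h n \<sigma> < x}"

end

(*
  The cycle through a given point of a uniform permutation of m points has uniformly distributed
  length j, and the rest is a uniform permutation of m - j points. Hence X_m = sum_j d(j) sqrt(j) alpha_j
  satisfies E psi(x + X_m) = (1/m) sum_{j<=m} E psi(x + d(j) sqrt(j) + X_{m-j}). A centred Gaussian of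
  variance m satisfies the same recursion exactly if d(j) is replaced by an independent standard
  Gaussian Z, so everything reduces to the equidistribution of j sqrt 2 modulo 1.

  Take psi monotone with values in [0,1] and Lipschitz constant L. Cut {1..m} into blocks of length q,
  where q is the denominator of a convergent p/q of sqrt 2. In a block, replacing sqrt(j) and m - j by
  constants costs O(L sqrt q log n) per term; what remains is a monotone function of Phi_inv(frac(j sqrt 2)),
  whose sum over the block is within 3 of q times its Gaussian mean, because the points are
  equally spaced up to one cell of length 1/q. The truncation at log j affects O(1) indices
  per block. So the recursion holds with an error eps = O(L sqrt q log n + 1/q), which accumulates to
  eps * harm n. For psi a ramp of width eta sqrt n, L = 1/(eta sqrt n), and undoing the smoothing
  costs eta; the choices q ~ sqrt n and eta = n^(-1/8) give the exponent 1/16.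
*)
theory Submission
  imports Defs
begin

section \<open>Splitting a permutation at the cycle through one point, and the resulting recursion
  for averages\<close>

section \<open>The cycle containing a given point\<close>

definition cycles_in :: "'a set \<Rightarrow> ('a \<Rightarrow> 'a) \<Rightarrow> 'a set set" where
  "cycles_in A \<sigma> = {C. C \<subseteq> A \<and> cyclic_on \<sigma> C}"

definition cyclic_perms :: "'a set \<Rightarrow> ('a \<Rightarrow> 'a) set" where
  "cyclic_perms C = {c. c permutes C \<and> cyclic_on c C}"

lemma finite_cycles_in: "finite A \<Longrightarrow> finite (cycles_in A \<sigma>)"
  by (simp add: cycles_in_def)

lemma finite_cyclic_perms: "finite C \<Longrightarrow> finite (cyclic_perms C)"
  by (rule finite_subset[OF _ finite_permutations[of C]]) (auto simp: cyclic_perms_def)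

lemma perm_restrict_comp_permutes:
  assumes "c permutes C" "\<tau> permutes D" "C \<inter> D = {}"
  shows "perm_restrict (c \<circ> \<tau>) C = c" "perm_restrict (c \<circ> \<tau>) D = \<tau>"
proof -
  have 1: "\<tau> x = x" if "x \<notin> D" for x using assms that by (simp add: permutes_def)
  have 2: "c x = x" if "x \<notin> C" for x using assms that by (simp add: permutes_def)
  have 3: "\<tau> x \<in> D" if "x \<in> D" for x using assms that by (simp add: permutes_in_image)
  show "perm_restrict (c \<circ> \<tau>) C = c" using 1 2 assms(3) by (fastforce simp: perm_restrict_def)
  show "perm_restrict (c \<circ> \<tau>) D = \<tau>" using 1 2 3 assms(3)
    by (auto simp: perm_restrict_def fun_eq_iff)
qed

lemma cyclic_on_comp:
  assumes "c \<in> cyclic_perms C" "\<tau> permutes D" "C \<inter> D = {}"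
  shows "cyclic_on (c \<circ> \<tau>) C"
  using permutes_comp_preserves_cyclic1[of \<tau> D c C C] assms by (auto simp: cyclic_perms_def)

text \<open>A permutation is determined by its orbit through \<open>a\<close>, its action on that
  orbit and its action on the remaining points. The inverse map \<open>g\<close> reads off these
  three data.\<close>

lemma bij_betw_permutes_cycle:
  assumes A: "finite A" "a \<in> A"
  shows "bij_betw (\<lambda>(C, c, \<tau>). c \<circ> \<tau>)
           (SIGMA C:{C. C \<subseteq> A \<and> a \<in> C}. cyclic_perms C \<times> {\<tau>. \<tau> permutes (A - C)})
           {\<sigma>. \<sigma> permutes A}" (is "bij_betw ?f ?X ?Y")
proof -
  define g where "g = (\<lambda>\<sigma>. (orbit \<sigma> a, perm_restrict \<sigma> (orbit \<sigma> a), perm_restrict \<sigma> (A - orbit \<sigma> a)))"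
  have 1: "g (?f z) = z \<and> ?f z \<in> ?Y" if "z \<in> ?X" for z
  proof -
    from that obtain C c \<tau> where z: "z = (C, c, \<tau>)" and
      *: "C \<subseteq> A" "a \<in> C" "c \<in> cyclic_perms C" "\<tau> permutes A - C" by (cases z) auto
    have "cyclic_on (c \<circ> \<tau>) C" using cyclic_on_comp[OF *(3,4)] by auto
    hence o: "orbit (c \<circ> \<tau>) a = C" using *(2) by (rule orbit_cyclic_eq3)
    have c: "c permutes C" using * by (simp add: cyclic_perms_def)
    have "c permutes A" "\<tau> permutes A" using * c by (auto intro: permutes_subset)
    hence "c \<circ> \<tau> permutes A" by (intro permutes_compose)
    moreover have "g (c \<circ> \<tau>) = (C, c, \<tau>)"
      using perm_restrict_comp_permutes[OF c *(4)] unfolding g_def o by auto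
    ultimately show ?thesis by (simp add: z)
  qed
  have 2: "?f (g \<sigma>) = \<sigma> \<and> g \<sigma> \<in> ?X" if "\<sigma> \<in> ?Y" for \<sigma>
  proof -
    from that have s: "\<sigma> permutes A" by simp
    let ?C = "orbit \<sigma> a"
    have c: "cyclic_on \<sigma> ?C" using s A(1) by (rule cyclic_on_orbit)
    have sub: "?C \<subseteq> A" using permutes_orbit_subset[OF s A(2)] .
    have a: "a \<in> ?C" using s A(1) by (auto intro!: permutation_self_in_orbit simp: permutation_permutes)
    have pC: "perm_restrict \<sigma> ?C permutes ?C"
    proof (rule bij_imp_permutes)
      have "inj_on \<sigma> ?C" using s by (meson inj_on_subset permutes_inj subset_UNIV)
      moreover have "\<sigma> ` ?C \<subseteq> ?C" using c by (auto intro: cyclic_on_inI)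
      moreover have "finite ?C" using sub A(1) finite_subset by blast
      ultimately have "bij_betw \<sigma> ?C ?C" by (simp add: bij_betw_def endo_inj_surj)
      thus "bij_betw (perm_restrict \<sigma> ?C) ?C ?C"
        by (subst bij_betw_cong[of _ _ \<sigma>]) (auto simp: perm_restrict_simps)
    qed (simp add: perm_restrict_simps)
    have pA: "perm_restrict \<sigma> (A - ?C) permutes (A - ?C)"
      using s c by (rule perm_restrict_diff_cyclic)
    have "perm_restrict \<sigma> ?C \<circ> perm_restrict \<sigma> (A - ?C) = perm_restrict \<sigma> (?C \<union> (A - ?C))"
      using pC pA by (rule perm_restrict_union) auto
    also have "\<dots> = \<sigma>" using sub s by (simp add: Un_absorb1)
    finally show ?thesis using sub a c pC pA
      by (simp add: g_def cyclic_perms_def cyclic_on_perm_restrict)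
  qed
  show ?thesis by (rule bij_betw_byWitness[of _ g]) (use 1 2 in \<open>blast+\<close>)
qed

lemma sum_permutes_cycle:
  assumes A: "finite A" "a \<in> A"
  shows "(\<Sum>\<sigma> | \<sigma> permutes A. f \<sigma>) =
    (\<Sum>C | C \<subseteq> A \<and> a \<in> C. \<Sum>c\<in>cyclic_perms C. \<Sum>\<tau> | \<tau> permutes (A - C). f (c \<circ> \<tau>))"
proof -
  have fin: "finite C" if "C \<subseteq> A" for C using A(1) that finite_subset by blast
  have "(\<Sum>\<sigma> | \<sigma> permutes A. f \<sigma>) = (\<Sum>(C, c, \<tau>) \<in>
     (SIGMA C:{C. C \<subseteq> A \<and> a \<in> C}. cyclic_perms C \<times> {\<tau>. \<tau> permutes (A - C)}). f (c \<circ> \<tau>))"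
    by (subst sum.reindex_bij_betw[OF bij_betw_permutes_cycle[OF A], symmetric]) (auto intro: sum.cong)
  also have "\<dots> = (\<Sum>C | C \<subseteq> A \<and> a \<in> C. \<Sum>(c,\<tau>)\<in>cyclic_perms C \<times> {\<tau>. \<tau> permutes (A - C)}. f (c \<circ> \<tau>))"
    by (subst sum.Sigma) (use A fin in \<open>auto intro!: finite_cyclic_perms finite_permutations\<close>)
  also have "\<dots> = (\<Sum>C | C \<subseteq> A \<and> a \<in> C. \<Sum>c\<in>cyclic_perms C. \<Sum>\<tau> | \<tau> permutes (A - C). f (c \<circ> \<tau>))"
    by (simp add: sum.cartesian_product)
  finally show ?thesis .
qed

text \<open>Two cycles of the same permutation that share a point coincide, so a cycle of
  \<open>c \<circ> \<tau>\<close> not contained in \<open>A - C\<close> must be \<open>C\<close>; on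
  \<open>A - C\<close> the factor \<open>c\<close> does nothing. The second claim lets the weight of
  \<open>C\<close> split off as a separate summand.\<close>

lemma cycles_in_comp:
  assumes c: "c \<in> cyclic_perms C" and t: "\<tau> permutes (A - C)" and CA: "C \<subseteq> A"
  shows "cycles_in A (c \<circ> \<tau>) = insert C (cycles_in (A - C) \<tau>)" "C \<notin> cycles_in (A - C) \<tau>"
proof -
  have cyc: "cyclic_on (c \<circ> \<tau>) C" using cyclic_on_comp[OF c t] by auto
  have c': "c permutes C" "C \<noteq> {}" using c by (auto simp: cyclic_perms_def cyclic_on_def)
  have eq: "cyclic_on (c \<circ> \<tau>) B \<longleftrightarrow> cyclic_on \<tau> B" if "B \<subseteq> A - C" for B
  proof -
    have "\<tau> x \<notin> C" if "x \<in> B" for x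
      using t that \<open>B \<subseteq> A - C\<close> by (metis DiffD2 permutes_in_image subsetD)
    hence "(c \<circ> \<tau>) x = \<tau> x" if "x \<in> B" for x
      using that c' by (auto simp: permutes_def)
    thus ?thesis by (rule cyclic_cong)
  qed
  have disj: "B = C" if "cyclic_on (c \<circ> \<tau>) B" "\<not> B \<subseteq> A - C" "B \<subseteq> A" for B
  proof -
    from that(2,3) obtain x where "x \<in> B" "x \<in> C" by auto
    thus ?thesis using orbit_cyclic_eq3[OF that(1)] orbit_cyclic_eq3[OF cyc] by metis
  qed
  show "cycles_in A (c \<circ> \<tau>) = insert C (cycles_in (A - C) \<tau>)"
  proof (intro set_eqI iffI)
    fix B assume "B \<in> cycles_in A (c \<circ> \<tau>)"
    thus "B \<in> insert C (cycles_in (A - C) \<tau>)"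
      using disj[of B] eq[of B] by (auto simp: cycles_in_def)
  next
    fix B assume B: "B \<in> insert C (cycles_in (A - C) \<tau>)"
    show "B \<in> cycles_in A (c \<circ> \<tau>)"
    proof (cases "B = C")
      case False
      thus ?thesis using B eq[of B] by (auto simp: cycles_in_def)
    qed (use CA cyc in \<open>simp add: cycles_in_def\<close>)
  qed
  show "C \<notin> cycles_in (A - C) \<tau>" using c' by (auto simp: cycles_in_def)
qed

text \<open>Removing \<open>a\<close> turns the sets of size \<open>j\<close> that contain it into
  all sets of size \<open>j - 1\<close> in \<open>A - {a}\<close>, which the binomial coefficient
  counts.\<close>

lemma sum_subsets_containing:
  fixes g :: "nat \<Rightarrow> real"
  assumes A: "finite A" "a \<in> A"
  shows "(\<Sum>C | C \<subseteq> A \<and> a \<in> C. g (card C)) =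
     (\<Sum>j=1..card A. real ((card A - 1) choose (j - 1)) * g j)"
proof -
  have m: "card A \<ge> 1" using A by (metis One_nat_def Suc_leI card_gt_0_iff empty_iff)
  have fin: "finite C" if "C \<subseteq> A" for C using A(1) that finite_subset by blast
  have cd: "Suc (card (C - {a})) = card C" if "C \<subseteq> A" "a \<in> C" for C
    using card_Suc_Diff1 fin that by metis
  have "(\<Sum>C | C \<subseteq> A \<and> a \<in> C. g (card C)) = (\<Sum>B \<in> Pow (A - {a}). g (Suc (card B)))"
    by (rule sum.reindex_bij_witness[of _ "insert a" "\<lambda>C. C - {a}"])
       (use A cd in \<open>simp_all add: insert_absorb\<close>, blast+)
  also have "\<dots> = (\<Sum>i\<in>{0..card A - 1}. \<Sum>B | B \<in> Pow (A - {a}) \<and> card B = i. g (Suc (card B)))"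
  proof (rule sum.group[symmetric])
    have "card B \<le> card A - 1" if "B \<subseteq> A - {a}" for B
      using card_mono[OF _ that] A by (simp add: card_Diff_singleton)
    thus "card ` Pow (A - {a}) \<subseteq> {0..card A - 1}" by auto
  qed (use A in auto)
  also have "\<dots> = (\<Sum>i\<in>{0..card A - 1}. real ((card A - 1) choose i) * g (Suc i))"
    using n_subsets[of "A - {a}"] A by (intro sum.cong) (auto simp: card_Diff_singleton)
  also have "\<dots> = (\<Sum>j=1..card A. real ((card A - 1) choose (j - 1)) * g j)"
    using m by (intro sum.reindex_bij_witness[of _ "\<lambda>j. j - 1" Suc]) auto
  finally show ?thesis .
qed

text \<open>Counting all permutations of \<open>A\<close> by the cycle of one point gives an equation whose only unknown,
  by induction, is the number of cyclic permutations of \<open>A\<close> itself.\<close>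
lemma card_cyclic_perms:
  assumes "finite A" "A \<noteq> {}"
  shows "card (cyclic_perms A) = fact (card A - 1)"
  using assms
proof (induction A rule: finite_psubset_induct)
  case (psubset A)
  then obtain a where a: "a \<in> A" by auto
  let ?m = "card A"
  have m: "?m \<ge> 1" using psubset.hyps(1) a by (auto simp: Suc_le_eq card_gt_0_iff)
  have fin: "finite C" if "C \<subseteq> A" for C by (rule finite_subset[OF that psubset.hyps(1)])
  have F: "fact ?m = (\<Sum>C | C \<subseteq> A \<and> a \<in> C. card (cyclic_perms C) * fact (?m - card C))"
    using sum_permutes_cycle[OF psubset.hyps(1) a, of "\<lambda>_. 1::nat"] psubset.hyps(1) fin
    by (simp add: card_permutations card_Diff_subset)
  have fs: "finite {C. C \<subseteq> A \<and> a \<in> C}" using psubset.hyps(1) by simp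
  \<comment> \<open>The induction hypothesis covers proper subsets only. The term of
    \<open>A\<close> is taken out, and afterwards the expected value \<open>fact (?m - 1)\<close> is
    put in its place to complete the sum.\<close>
  have "real (fact ?m) = real (card (cyclic_perms A)) + (\<Sum>C\<in>{C. C \<subseteq> A \<and> a \<in> C} - {A}. real (card (cyclic_perms C) * fact (?m - card C)))"
    unfolding F of_nat_sum using a fs by (subst sum.remove[of _ A]) auto
  also have "(\<Sum>C\<in>{C. C \<subseteq> A \<and> a \<in> C} - {A}. real (card (cyclic_perms C) * fact (?m - card C)))
     = (\<Sum>C\<in>{C. C \<subseteq> A \<and> a \<in> C} - {A}. real (fact (card C - 1) * fact (?m - card C)))"
    by (intro sum.cong refl) (subst psubset.IH, auto)
  also have "\<dots> = (\<Sum>C\<in>{C. C \<subseteq> A \<and> a \<in> C}. fact (card C - 1) * fact (?m - card C)) - fact (?m - 1)"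
    using a fs by (subst (2) sum.remove[of _ A]) auto
  also have "(\<Sum>C\<in>{C. C \<subseteq> A \<and> a \<in> C}. fact (card C - 1) * fact (?m - card C)) =
     (\<Sum>j=1..?m. real ((?m - 1) choose (j - 1)) * (fact (j - 1) * fact (?m - j)))"
    by (rule sum_subsets_containing[OF psubset.hyps(1) a])
  \<comment> \<open>The binomial coefficient cancels the two factorials, so each of the
    \<open>?m\<close> lengths contributes equally: the cycle length is uniformly
    distributed.\<close>
  also have "\<dots> = (\<Sum>j=1..?m. fact (?m - 1))"
  proof (intro sum.cong refl)
    fix j assume j: "j \<in> {1..?m}"
    have "fact (j - 1) * fact (?m - 1 - (j - 1)) * ((?m - 1) choose (j - 1)) = fact (?m - 1)"
      using j by (intro binomial_fact_lemma) auto
    from arg_cong[OF this, of real] j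
    show "real ((?m - 1) choose (j - 1)) * (fact (j - 1) * fact (?m - j)) = fact (?m - 1)"
      by (simp add: mult_ac)
  qed
  also have "\<dots> = real (fact ?m)" using m by (simp add: fact_reduce)
  finally have "real (card (cyclic_perms A)) = real (fact (?m - 1))" by simp
  thus ?case by (rule of_nat_eq_iff[THEN iffD1])
qed

text \<open>This is the expectation of \<open>\<psi> (x + X)\<close>, where \<open>X\<close> adds up
  \<open>w\<close> over the cycle lengths of a uniform permutation of \<open>m\<close> points. The
  recursive form lets the later estimates run by induction on \<open>m\<close> without mentioning
  permutations.\<close>

function perm_avg :: "(nat \<Rightarrow> real) \<Rightarrow> (real \<Rightarrow> real) \<Rightarrow> nat \<Rightarrow> real \<Rightarrow> real" where
  "perm_avg w \<psi> 0 x = \<psi> x"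
| "perm_avg w \<psi> (Suc m) x = (\<Sum>j=1..Suc m. perm_avg w \<psi> (Suc m - j) (x + w j)) / real (Suc m)"
  by pat_completeness auto
termination by (relation "inv_image less_than (\<lambda>(w, \<psi>, m, x). m)") auto

declare perm_avg.simps(2)[simp del]

lemma perm_avg_rec:
  "m \<ge> 1 \<Longrightarrow> perm_avg w \<psi> m x = (\<Sum>j=1..m. perm_avg w \<psi> (m - j) (x + w j)) / real m"
proof (cases m)
  case (Suc k)
  show ?thesis unfolding Suc by (rule perm_avg.simps(2))
qed simp

text \<open>Permutations are sorted by the cycle of one point. Length \<open>j\<close> arises from a
  choice of its other points and of one of \<open>fact (j - 1)\<close> cyclic arrangements; together
  with the \<open>fact (m - j)\<close> permutations of the rest, where \<open>m = card A\<close>,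
  this has total weight \<open>fact (m - 1)\<close> for every \<open>j\<close>, which is the uniform
  weight in the recursion.\<close>

lemma sum_permutes_perm_avg:
  assumes "finite A"
  shows "(\<Sum>\<sigma> | \<sigma> permutes A. \<psi> (x + (\<Sum>C\<in>cycles_in A \<sigma>. w (card C)))) =
    fact (card A) * perm_avg w \<psi> (card A) x"
  using assms
proof (induction A arbitrary: x rule: finite_psubset_induct)
  case (psubset A)
  show ?case
  proof (cases "A = {}")
    case True
    have "cycles_in {} \<sigma> = {}" for \<sigma> :: "'a \<Rightarrow> 'a" by (auto simp: cycles_in_def cyclic_on_def)
    thus ?thesis using True by simp
  next
    case False
    then obtain a where a: "a \<in> A" by auto
    let ?m = "card A"
    have m: "?m \<ge> 1" using psubset.hyps(1) a by (auto simp: Suc_le_eq card_gt_0_iff)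
    have fin: "finite C" if "C \<subseteq> A" for C by (rule finite_subset[OF that psubset.hyps(1)])
    have 1: "(\<Sum>\<tau> | \<tau> permutes (A - C). \<psi> (x + (\<Sum>D\<in>cycles_in A (c \<circ> \<tau>). w (card D)))) =
       fact (?m - card C) * perm_avg w \<psi> (?m - card C) (x + w (card C))"
      if "C \<subseteq> A" "a \<in> C" "c \<in> cyclic_perms C" for C c
    proof -
      have "(\<Sum>\<tau> | \<tau> permutes (A - C). \<psi> (x + (\<Sum>D\<in>cycles_in A (c \<circ> \<tau>). w (card D)))) =
         (\<Sum>\<tau> | \<tau> permutes (A - C). \<psi> ((x + w (card C)) + (\<Sum>D\<in>cycles_in (A - C) \<tau>. w (card D))))"
        using that psubset.hyps(1)
        by (intro sum.cong refl) (simp add: cycles_in_comp finite_cycles_in add_ac)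
      also have "\<dots> = fact (card (A - C)) * perm_avg w \<psi> (card (A - C)) (x + w (card C))"
        using that a by (intro psubset.IH) auto
      finally show ?thesis using that fin by (simp add: card_Diff_subset)
    qed
    have "(\<Sum>\<sigma> | \<sigma> permutes A. \<psi> (x + (\<Sum>C\<in>cycles_in A \<sigma>. w (card C)))) =
       (\<Sum>C | C \<subseteq> A \<and> a \<in> C. fact (card C - 1) * (fact (?m - card C) * perm_avg w \<psi> (?m - card C) (x + w (card C))))"
      unfolding sum_permutes_cycle[OF psubset.hyps(1) a]
    proof (intro sum.cong refl)
      fix C assume C: "C \<in> {C. C \<subseteq> A \<and> a \<in> C}"
      hence "card (cyclic_perms C) = fact (card C - 1)" using fin by (intro card_cyclic_perms) auto
      thus "(\<Sum>c\<in>cyclic_perms C. \<Sum>\<tau> | \<tau> permutes (A - C). \<psi> (x + (\<Sum>D\<in>cycles_in A (c \<circ> \<tau>). w (card D)))) =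
         fact (card C - 1) * (fact (?m - card C) * perm_avg w \<psi> (?m - card C) (x + w (card C)))"
        using C by (simp add: 1)
    qed
    also have "\<dots> = (\<Sum>j=1..?m. real ((?m - 1) choose (j - 1)) * (fact (j - 1) * (fact (?m - j) * perm_avg w \<psi> (?m - j) (x + w j))))"
      by (rule sum_subsets_containing[OF psubset.hyps(1) a])
    also have "\<dots> = (\<Sum>j=1..?m. fact (?m - 1) * perm_avg w \<psi> (?m - j) (x + w j))"
    proof (intro sum.cong refl)
      fix j assume j: "j \<in> {1..?m}"
      have "fact (j - 1) * fact (?m - 1 - (j - 1)) * ((?m - 1) choose (j - 1)) = fact (?m - 1)"
        using j by (intro binomial_fact_lemma) auto
      from arg_cong[OF this, of real] j
      have "real ((?m - 1) choose (j - 1)) * fact (j - 1) * fact (?m - j) = fact (?m - 1)"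
        by (simp add: mult_ac)
      thus "real ((?m - 1) choose (j - 1)) * (fact (j - 1) * (fact (?m - j) * perm_avg w \<psi> (?m - j) (x + w j))) = fact (?m - 1) * perm_avg w \<psi> (?m - j) (x + w j)"
        by (metis mult.assoc)
    qed
    also have "\<dots> = fact ?m * perm_avg w \<psi> ?m x"
      using m by (subst (2) perm_avg_rec) (simp_all add: fact_reduce sum_distrib_left sum_divide_distrib)
    finally show ?thesis .
  qed
qed

section \<open>Pell approximations to \<open>sqrt 2\<close> and the cells visited by the
  rotation\<close>

section \<open>Rotation by the square root of two\<close>

text \<open>The map from \<open>(p, q)\<close> to \<open>(p + 2 * q, p + q)\<close> flips the sign
  of \<open>p^2 - 2 * q^2\<close>, and \<open>p \<le> 2 * q\<close> ensures that the denominator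
  grows at most threefold. Hence no interval from \<open>N / 3\<close> to \<open>N\<close> is
  skipped.\<close>

lemma pell_exists:
  assumes "N \<ge> (1::nat)"
  shows "\<exists>p q. q \<ge> 1 \<and> q \<le> N \<and> N < 3 * q \<and> p \<le> 2 * q \<and> \<bar>(int p)\<^sup>2 - 2 * (int q)\<^sup>2\<bar> = 1"
  using assms
proof (induction N rule: nat_induct_at_least)
  case base
  show ?case by (rule exI[of _ 1], rule exI[of _ 1]) auto
next
  case (Suc N)
  then obtain p q where *: "q \<ge> 1" "q \<le> N" "N < 3 * q" "p \<le> 2 * q" "\<bar>(int p)\<^sup>2 - 2 * (int q)\<^sup>2\<bar> = 1"
    by auto
  show ?case
  proof (cases "Suc N < 3 * q")
    case True
    thus ?thesis using * by (intro exI[of _ p] exI[of _ q]) auto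
  next
    case False
    \<comment> \<open>Positivity of \<open>p\<close> makes the next denominator exceed
      \<open>q\<close>, which gives the strict bound \<open>Suc N < 3 * (p + q)\<close>.\<close>
    have "p \<noteq> 0"
    proof
      assume "p = 0"
      hence "2 * (int q)\<^sup>2 = 1" using *(5) by simp
      thus False by presburger
    qed
    moreover have "(int (p + 2 * q))\<^sup>2 - 2 * (int (p + q))\<^sup>2 = - ((int p)\<^sup>2 - 2 * (int q)\<^sup>2)"
      by (simp add: power2_eq_square algebra_simps)
    ultimately show ?thesis using * False
      by (intro exI[of _ "p + 2 * q"] exI[of _ "p + q"]) auto
  qed
qed

text \<open>Factoring the Pell expression gives
  \<open>\<bar>q * sqrt 2 - p\<bar> = 1 / (q * sqrt 2 + p)\<close>, and the denominator exceeds
  \<open>q\<close>.\<close>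

lemma pell_approx:
  assumes "q \<ge> 1" "\<bar>(int p)\<^sup>2 - 2 * (int q)\<^sup>2\<bar> = 1"
  shows "real q * \<bar>real q * sqrt 2 - real p\<bar> < 1"
proof -
  have "real_of_int \<bar>(int p)\<^sup>2 - 2 * (int q)\<^sup>2\<bar> = \<bar>(real q * sqrt 2 - real p) * (real q * sqrt 2 + real p)\<bar>"
    by (simp add: algebra_simps power2_eq_square)
  hence "\<bar>real q * sqrt 2 - real p\<bar> * (real q * sqrt 2 + real p) = 1"
    using assms by (simp add: abs_mult)
  moreover have "real q * 1 < real q * sqrt 2" using assms by (intro mult_strict_left_mono) auto
  hence "real q < real q * sqrt 2 + real p" by simp
  moreover have "\<bar>real q * sqrt 2 - real p\<bar> > 0"
    using calculation(1) by (metis mult_zero_left zero_less_abs_iff zero_neq_one abs_zero)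
  ultimately show ?thesis by (metis mult.commute mult_strict_left_mono)
qed

text \<open>Irrationality by Pell approximation: if \<open>j * sqrt 2\<close> were an integer
  \<open>k\<close>, then for a Pell pair with \<open>q > j\<close> the integer
  \<open>q * k - p * j\<close> would have absolute value below 1. Its vanishing would force
  \<open>q * sqrt 2 = p\<close>, against the Pell equation.\<close>

lemma frac_sqrt2_pos:
  assumes "j \<ge> 1"
  shows "frac (real j * sqrt 2) > 0"
proof (rule ccontr)
  assume "\<not> ?thesis"
  hence "frac (real j * sqrt 2) = 0" using frac_ge_0[of "real j * sqrt 2"] by linarith
  then obtain k where k: "real j * sqrt 2 = of_int k" by (auto simp: frac_eq_0_iff elim: Ints_cases)
  obtain p q where pq: "q \<ge> 1" "3 * j < 3 * q" "\<bar>(int p)\<^sup>2 - 2 * (int q)\<^sup>2\<bar> = 1"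
    using pell_exists[of "3 * j"] assms by auto
  have "real_of_int \<bar>int q * k - int p * int j\<bar> = real j * \<bar>real q * sqrt 2 - real p\<bar>"
    using k by (simp add: abs_mult_pos' algebra_simps flip: k)
  also have "\<dots> \<le> real q * \<bar>real q * sqrt 2 - real p\<bar>"
    using pq by (intro mult_right_mono) auto
  also have "\<dots> < 1" using pell_approx pq by auto
  finally have "int q * k = int p * int j" by linarith
  hence "real_of_int (int q * k) = real_of_int (int p * int j)" by (rule arg_cong)
  hence "real q * (real j * sqrt 2) = real p * real j" unfolding k by simp
  hence "real q * sqrt 2 = real p" using assms by simp
  hence "(real q * sqrt 2)\<^sup>2 = (real p)\<^sup>2" by (rule arg_cong)
  hence "real_of_int ((int p)\<^sup>2) = real_of_int (2 * (int q)\<^sup>2)" by (simp add: power_mult_distrib)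
  hence "(int p)\<^sup>2 = 2 * (int q)\<^sup>2" by (simp only: of_int_eq_iff)
  thus False using pq by simp
qed

lemma floor_mult_frac:
  assumes "q \<ge> (1::nat)"
  shows "\<lfloor>real q * frac y\<rfloor> = \<lfloor>real q * y\<rfloor> mod int q"
proof -
  have "\<lfloor>real q * frac y\<rfloor> = \<lfloor>real q * y - of_int (int q * \<lfloor>y\<rfloor>)\<rfloor>"
    by (simp add: frac_def algebra_simps)
  also have "\<dots> = \<lfloor>real q * y\<rfloor> - int q * \<lfloor>y\<rfloor>" by (rule floor_diff_of_int)
  finally have eq: "\<lfloor>real q * frac y\<rfloor> = \<lfloor>real q * y\<rfloor> - int q * \<lfloor>y\<rfloor>" .
  have "0 \<le> \<lfloor>real q * frac y\<rfloor>" by simp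
  moreover have "real q * frac y < real q * 1" using assms frac_lt_1 by (intro mult_strict_left_mono) auto
  hence "\<lfloor>real q * frac y\<rfloor> < int q" by (simp add: floor_less_iff)
  ultimately have "\<lfloor>real q * frac y\<rfloor> mod int q = \<lfloor>real q * frac y\<rfloor>" by simp
  moreover have "\<lfloor>real q * frac y\<rfloor> mod int q = \<lfloor>real q * y\<rfloor> mod int q" unfolding eq
    by (metis mod_mult_self2 mult_minus_right diff_conv_add_uminus)
  ultimately show ?thesis by simp
qed

text \<open>Multiplication by a unit followed by a shift permutes the residues modulo
  \<open>q\<close>.\<close>

lemma sum_residues:
  fixes f :: "int \<Rightarrow> real"
  assumes "q \<ge> 1" "coprime p (int q)"
  shows "(\<Sum>i<q. f ((s + int i * p) mod int q)) = (\<Sum>r<q. f (int r))"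
proof -
  have inj: "inj_on (\<lambda>i. nat ((s + int i * p) mod int q)) {..<q}"
  proof (rule inj_onI)
    fix i j assume ij: "i \<in> {..<q}" "j \<in> {..<q}"
      and "nat ((s + int i * p) mod int q) = nat ((s + int j * p) mod int q)"
    hence "(s + int i * p) mod int q = (s + int j * p) mod int q"
      using assms by (subst (asm) eq_nat_nat_iff) auto
    hence "int q dvd (s + int i * p) - (s + int j * p)" by (simp add: mod_eq_dvd_iff)
    hence "int q dvd (int i - int j) * p" by (simp add: algebra_simps)
    hence "int q dvd int i - int j"
      using assms(2) coprime_dvd_mult_left_iff[of "int q" p] by (simp add: coprime_commute)
    moreover have "\<bar>int i - int j\<bar> < int q" using ij by auto
    ultimately have "int i - int j = 0" using dvd_imp_le_int[of "int i - int j" "int q"] by linarith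
    thus "i = j" by simp
  qed
  moreover have "(\<lambda>i. nat ((s + int i * p) mod int q)) ` {..<q} \<subseteq> {..<q}"
    using assms by (auto simp: nat_less_iff)
  ultimately have "bij_betw (\<lambda>i. nat ((s + int i * p) mod int q)) {..<q} {..<q}"
    by (simp add: bij_betw_def endo_inj_surj)
  hence "(\<Sum>i<q. f (int (nat ((s + int i * p) mod int q)))) = (\<Sum>r<q. f (int r))"
    by (rule sum.reindex_bij_betw)
  thus ?thesis using assms by simp
qed

lemma sum_shift_le:
  fixes \<gamma> :: "int \<Rightarrow> real"
  assumes "\<And>k. 0 \<le> \<gamma> k" "\<And>k. \<gamma> k \<le> 1"
  shows "\<bar>(\<Sum>r<q. \<gamma> (int r + 1)) - (\<Sum>r<q. \<gamma> (int r))\<bar> \<le> 1"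
proof -
  have "(\<Sum>r<q. \<gamma> (int r + 1)) - (\<Sum>r<q. \<gamma> (int r)) = \<gamma> (int q) - \<gamma> 0"
    using sum_lessThan_telescope[of "\<lambda>r. \<gamma> (int r)" q] by (simp add: sum_subtractf add.commute)
  thus ?thesis using assms[of "int q"] assms[of 0] by linarith
qed

locale pell =
  fixes p q :: nat
  assumes q: "q \<ge> 1" and pell: "\<bar>(int p)\<^sup>2 - 2 * (int q)\<^sup>2\<bar> = 1"
begin

lemma coprime_pq: "coprime (int p) (int q)"
proof (rule coprimeI)
  fix c assume "c dvd int p" "c dvd int q"
  hence "c dvd (int p)\<^sup>2 - 2 * (int q)\<^sup>2" by (simp add: power2_eq_square)
  thus "is_unit c" using pell by (metis dvd_abs_iff)
qed

text \<open>
  As \<open>\<bar>sqrt 2 - p / q\<bar> < 1 / q\<^sup>2\<close>, over \<open>q\<close> consecutive indices the rotation by \<open>sqrt 2\<close> stays within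
  \<open>1 / q\<close> of the rotation by \<open>p / q\<close>, which visits each cell of length \<open>1 / q\<close> exactly once.
\<close>
lemma cell_index:
  assumes "i < q"
  obtains e where "e \<in> {-1, 0, 1}"
    "\<lfloor>real q * frac (real (a + i) * sqrt 2)\<rfloor> = ((\<lfloor>real q * real a * sqrt 2\<rfloor> + int i * int p) mod int q + e) mod int q"
proof -
  define \<delta> where "\<delta> = real i * (real q * sqrt 2 - real p)"
  define w where "w = real q * real a * sqrt 2"
  have "\<bar>\<delta>\<bar> = real i * \<bar>real q * sqrt 2 - real p\<bar>" by (simp add: \<delta>_def abs_mult)
  also have "\<dots> \<le> real q * \<bar>real q * sqrt 2 - real p\<bar>" using assms by (intro mult_right_mono) auto
  also have "\<dots> < 1" using pell_approx[OF q pell] .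
  finally have d: "\<bar>\<delta>\<bar> < 1" .
  have "real q * (real (a + i) * sqrt 2) = w + \<delta> + of_int (int i * int p)"
    by (simp add: w_def \<delta>_def algebra_simps)
  hence "\<lfloor>real q * (real (a + i) * sqrt 2)\<rfloor> = \<lfloor>w + \<delta>\<rfloor> + int i * int p"
    by (simp only: floor_add_int)
  moreover have "\<lfloor>w + \<delta>\<rfloor> - \<lfloor>w\<rfloor> \<in> {-1, 0, 1}" using d by (simp, linarith)
  moreover have "\<lfloor>real q * frac (real (a + i) * sqrt 2)\<rfloor> = \<lfloor>real q * (real (a + i) * sqrt 2)\<rfloor> mod int q"
    using floor_mult_frac[OF q] .
  moreover have "((\<lfloor>w\<rfloor> + int i * int p) mod int q + (\<lfloor>w + \<delta>\<rfloor> - \<lfloor>w\<rfloor>)) mod int q = (\<lfloor>w + \<delta>\<rfloor> + int i * int p) mod int q"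
    by (subst mod_add_left_eq) (rule arg_cong[of _ _ "\<lambda>x. x mod int q"], simp)
  ultimately show ?thesis
    by (intro that[of "\<lfloor>w + \<delta>\<rfloor> - \<lfloor>w\<rfloor>"]) (simp_all only: w_def)
qed

text \<open>The index \<open>r i\<close> of the rotation by \<open>p / q\<close> runs once through
  all residues, and \<open>c i\<close> differs from it by at most one step around the circle. Above,
  two shifts of the argument and the wrap from cell 0 to cell \<open>q - 1\<close> cost 1 each;
  below, one shift and the opposite wrap do.\<close>

lemma sum_cells:
  fixes \<gamma> :: "int \<Rightarrow> real"
  assumes g0: "\<And>k. 0 \<le> \<gamma> k" and g1: "\<And>k. \<gamma> k \<le> 1" and mono: "mono \<gamma>"
    and c: "\<And>i. c i = \<lfloor>real q * frac (real (a + i) * sqrt 2)\<rfloor>"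
  shows "(\<Sum>i<q. \<gamma> (c i + 1)) \<le> (\<Sum>r<q. \<gamma> (int r)) + 3"
    and "(\<Sum>i<q. \<gamma> (c i)) \<ge> (\<Sum>r<q. \<gamma> (int r)) - 2"
proof -
  define s where "s = \<lfloor>real q * real a * sqrt 2\<rfloor>"
  define r where "r = (\<lambda>i. (s + int i * int p) mod int q)"
  have r: "0 \<le> r i" "r i < int q" for i using q by (auto simp: r_def)
  have cr: "c i = r i \<or> c i = r i - 1 \<or> c i = r i + 1 \<or> (r i = 0 \<and> c i = int q - 1) \<or> (r i = int q - 1 \<and> c i = 0)"
    if i: "i < q" for i
  proof -
    obtain e where e: "e \<in> {-1, 0, 1}" "c i = (r i + e) mod int q"
      using cell_index[OF i] unfolding c r_def s_def by metis
    consider "0 \<le> r i + e \<and> r i + e < int q" | "r i + e = -1" | "r i + e = int q"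
      using e(1) r[of i] by fastforce
    thus ?thesis
    proof cases
      case 2
      hence "r i = 0" "c i = int q - 1" using e r[of i] q by (auto simp: zmod_minus1)
      thus ?thesis by simp
    qed (use e r[of i] in auto)
  qed
  have sum_r: "(\<Sum>i<q. f (r i)) = (\<Sum>k<q. f (int k))" for f :: "int \<Rightarrow> real"
    unfolding r_def using sum_residues[OF q coprime_pq] .
  have m: "\<gamma> x \<le> \<gamma> y" if "x \<le> y" for x y using mono that by (auto dest: monoD)
  have single: "(\<Sum>k<q. if int k = int k0 then 1 else 0::real) = 1" if "k0 < q" for k0
    using that by (simp add: sum.delta')
  have "(\<Sum>i<q. \<gamma> (c i + 1)) \<le> (\<Sum>i<q. \<gamma> (r i + 1 + 1) + (if r i = int 0 then 1 else 0))"
  proof (rule sum_mono)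
    fix i assume "i \<in> {..<q}"
    hence "c i \<le> r i + 1 \<or> r i = 0" using cr[of i] r[of i] by auto
    thus "\<gamma> (c i + 1) \<le> \<gamma> (r i + 1 + 1) + (if r i = int 0 then 1 else 0)"
      using m[of "c i + 1" "r i + 1 + 1"] g1[of "c i + 1"] g0[of "r i + 1 + 1"] by auto
  qed
  also have "\<dots> = (\<Sum>k<q. \<gamma> (int k + 1 + 1)) + 1"
    using sum_r[of "\<lambda>r. \<gamma> (r + 1 + 1)"] sum_r[of "\<lambda>r. if r = int 0 then 1 else 0"] single[of 0] q
    by (simp add: sum.distrib)
  finally show "(\<Sum>i<q. \<gamma> (c i + 1)) \<le> (\<Sum>r<q. \<gamma> (int r)) + 3"
    using sum_shift_le[of \<gamma> q] sum_shift_le[of "\<lambda>k. \<gamma> (k + 1)" q] g0 g1 by simp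
  have "(\<Sum>i<q. \<gamma> (r i - 1)) - 1 = (\<Sum>i<q. \<gamma> (r i - 1) - (if r i = int (q - 1) then 1 else 0))"
    using sum_r[of "\<lambda>r. if r = int (q - 1) then 1 else 0"] single[of "q - 1"] q
    by (simp add: sum_subtractf)
  also have "\<dots> \<le> (\<Sum>i<q. \<gamma> (c i))"
  proof (rule sum_mono)
    fix i assume "i \<in> {..<q}"
    hence "r i - 1 \<le> c i \<or> r i = int (q - 1)" using cr[of i] r[of i] q by auto
    thus "\<gamma> (r i - 1) - (if r i = int (q - 1) then 1 else 0) \<le> \<gamma> (c i)"
      using m[of "r i - 1" "c i"] g0[of "c i"] g1[of "r i - 1"] by auto
  qed
  finally show "(\<Sum>i<q. \<gamma> (c i)) \<ge> (\<Sum>r<q. \<gamma> (int r)) - 2"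
    using sum_shift_le[of "\<lambda>k. \<gamma> (k - 1)" q] g0 g1 sum_r[of "\<lambda>r. \<gamma> (r - 1)"] by simp
qed

end

section \<open>The normal distribution function, its inverse, and equidistribution of the quantiles
  over a block\<close>

section \<open>Gaussian quantiles along the rotation\<close>

abbreviation "N01 \<equiv> std_normal_distribution"

interpretation N01: real_distribution N01 by (rule real_dist_normal_dist)

lemma std_normal_density_le_1: "std_normal_density x \<le> 1"
proof -
  have "1 \<le> sqrt (2 * pi)" using pi_gt3 by (intro real_le_rsqrt) auto
  moreover have "exp (- x\<^sup>2 / 2) \<le> 1" by simp
  ultimately have "exp (- x\<^sup>2 / 2) / sqrt (2 * pi) \<le> 1 / 1" by (intro frac_le) auto
  thus ?thesis unfolding std_normal_density_def by simp
qed

lemma measure_N01: "A \<in> sets borel \<Longrightarrow> measure N01 A = (\<integral>x. indicator A x * std_normal_density x \<partial>lborel)"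
proof -
  assume A: "A \<in> sets borel"
  have "measure N01 A = (\<integral>x. indicator A x \<partial>N01)" using A by simp
  also have "\<dots> = (\<integral>x. std_normal_density x *\<^sub>R indicator A x \<partial>lborel)"
    using A by (intro integral_density) auto
  finally show ?thesis by (simp add: mult.commute)
qed

lemma Phi_diff:
  assumes "x < y"
  shows "0 < Phi y - Phi x" "Phi y - Phi x \<le> y - x"
proof -
  have eq: "Phi y - Phi x = (\<integral>t. indicator {x<..y} t * std_normal_density t \<partial>lborel)"
    unfolding Phi_def using assms by (subst N01.cdf_diff_eq) (auto simp: measure_N01)
  have int: "integrable lborel (\<lambda>t. indicator {x<..y} t * std_normal_density t)"
    using integrable_real_mult_indicator[of "{x<..y}" lborel std_normal_density] by (simp add: mult.commute)
  have int2: "integrable lborel (\<lambda>t. indicator {x<..y} t * c)" for c :: real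
    using assms by (intro integrable_mult_left integrable_real_indicator) (auto simp: emeasure_lborel_Ioc)
  have "(\<integral>t. indicator {x<..y} t * std_normal_density t \<partial>lborel) \<le> (\<integral>t. indicator {x<..y} t * 1 \<partial>lborel)"
    using int int2[of 1] by (intro integral_mono) (auto simp: indicator_def std_normal_density_le_1)
  thus "Phi y - Phi x \<le> y - x" using assms by (simp add: eq)
  \<comment> \<open>The density decreases in the modulus of its argument, so this value is a
    positive lower bound for it on the whole interval.\<close>
  let ?c = "std_normal_density (\<bar>x\<bar> + \<bar>y\<bar>)"
  have "(\<integral>t. indicator {x<..y} t * ?c \<partial>lborel) \<le> (\<integral>t. indicator {x<..y} t * std_normal_density t \<partial>lborel)"
  proof (intro integral_mono int int2)
    fix t
    show "indicator {x<..y} t * ?c \<le> indicator {x<..y} t * std_normal_density t"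
    proof (cases "t \<in> {x<..y}")
      case True
      hence "t\<^sup>2 \<le> (\<bar>x\<bar> + \<bar>y\<bar>)\<^sup>2" by (intro abs_le_square_iff[THEN iffD1]) auto
      thus ?thesis using True by (auto simp: std_normal_density_def divide_right_mono)
    qed auto
  qed
  moreover have "?c * (y - x) > 0" using assms by (simp add: normal_density_pos)
  ultimately show "0 < Phi y - Phi x" using assms by (simp add: eq mult.commute)
qed

lemma Phi_less_iff: "Phi x < Phi y \<longleftrightarrow> x < y"
  using Phi_diff(1)[of x y] Phi_diff(1)[of y x] by (cases x y rule: linorder_cases) auto

lemma Phi_le_iff: "Phi x \<le> Phi y \<longleftrightarrow> x \<le> y"
  using Phi_less_iff[of y x] by linarith

lemma Phi_lipschitz: "\<bar>Phi x - Phi y\<bar> \<le> \<bar>x - y\<bar>"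
  using Phi_diff[of x y] Phi_diff[of y x] by (cases x y rule: linorder_cases) auto

lemma Phi_gt_0: "0 < Phi x" and Phi_lt_1: "Phi x < 1"
proof -
  have "0 \<le> Phi (x - 1)" "Phi (x + 1) \<le> 1" unfolding Phi_def by (simp_all add: N01.cdf_nonneg N01.cdf_bounded_prob)
  thus "0 < Phi x" "Phi x < 1" using Phi_diff(1)[of "x - 1" x] Phi_diff(1)[of x "x + 1"] by auto
qed

lemma isCont_Phi: "isCont Phi x"
proof -
  have "continuous_on UNIV Phi"
  proof (rule continuous_onI)
    fix x e :: real assume "e > 0"
    thus "\<exists>d>0. \<forall>x'\<in>UNIV. dist x' x < d \<longrightarrow> dist (Phi x') (Phi x) \<le> e"
      using order.strict_trans1[OF Phi_lipschitz] by (intro exI[of _ e]) (force simp: dist_real_def less_imp_le)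
  qed
  thus ?thesis by (simp add: continuous_on_eq_continuous_at)
qed

text \<open>\<open>inv\<close> is a right inverse only on the range, so \<open>u\<close> has to be
  attained. This follows from the limits of the distribution function and the intermediate value
  theorem.\<close>

lemma Phi_Phi_inv:
  assumes "0 < u" "u < 1"
  shows "Phi (Phi_inv u) = u"
proof -
  have "eventually (\<lambda>x. u < Phi x) at_top" unfolding Phi_def
    using order_tendstoD(1)[OF N01.cdf_lim_at_top_prob] assms by simp
  then obtain b where b: "u < Phi b" by (auto simp: eventually_at_top_linorder)
  have "eventually (\<lambda>x. Phi x < u) at_bot" unfolding Phi_def
    using order_tendstoD(2)[OF N01.cdf_lim_at_bot] assms by simp
  then obtain a where a: "Phi a < u" by (auto simp: eventually_at_bot_linorder)
  have "a \<le> b" using a b Phi_less_iff[of a b] by simp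
  hence "\<exists>x. a \<le> x \<and> x \<le> b \<and> Phi x = u" using a b isCont_Phi by (intro IVT) auto
  hence "u \<in> range Phi" by auto
  thus ?thesis unfolding Phi_inv_def by (rule f_inv_into_f)
qed

lemma Phi_inv_le_iff: "0 < u \<Longrightarrow> u < 1 \<Longrightarrow> Phi_inv u \<le> z \<longleftrightarrow> u \<le> Phi z"
  using Phi_le_iff[of "Phi_inv u" z] Phi_Phi_inv[of u] by metis

lemma le_Phi_inv_iff: "0 < u \<Longrightarrow> u < 1 \<Longrightarrow> z \<le> Phi_inv u \<longleftrightarrow> Phi z \<le> u"
  using Phi_le_iff[of z "Phi_inv u"] Phi_Phi_inv[of u] by metis

text \<open>\<open>Phi\<close> of a standard normal variable is uniform on the unit interval. The
  endpoints are treated apart because \<open>Phi_inv\<close> is unspecified there.\<close>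

lemma measure_N01_Phi_less:
  assumes "0 \<le> u" "u \<le> 1"
  shows "measure N01 {z. Phi z < u} = u"
proof -
  consider "u = 0" | "u = 1" | "0 < u" "u < 1" using assms by linarith
  thus ?thesis
  proof cases
    case 1
    have "{z. Phi z < 0} = {}" using Phi_gt_0 by (auto simp: not_less less_imp_le)
    thus ?thesis unfolding 1 by (metis measure_empty)
  next
    case 2
    have "{z. Phi z < 1} = space N01" using Phi_lt_1 by auto
    thus ?thesis unfolding 2 by (metis N01.prob_space)
  next
    case 3
    have iff: "Phi z < u \<longleftrightarrow> z < Phi_inv u" for z
      using Phi_less_iff[of z "Phi_inv u"] unfolding Phi_Phi_inv[OF 3] .
    have "{z. Phi z < u} = {..Phi_inv u} - {Phi_inv u}"
      by (intro set_eqI, simp only: iff mem_Collect_eq Diff_iff atMost_iff singleton_iff) (rule less_le)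
    moreover have "measure N01 {Phi_inv u} = 0"
      using isCont_Phi[of "Phi_inv u"] by (simp add: Phi_def N01.isCont_cdf)
    moreover have "measure N01 {..Phi_inv u} = u" using Phi_Phi_inv[OF 3] by (simp add: Phi_def cdf_def)
    moreover have "measure N01 ({..Phi_inv u} - {Phi_inv u}) = measure N01 {..Phi_inv u} - measure N01 {Phi_inv u}"
      by (rule N01.finite_measure_Diff) auto
    ultimately show ?thesis by (simp only: diff_zero)
  qed
qed

lemma borel_measurable_Phi[measurable]: "Phi \<in> borel_measurable borel"
  by (intro borel_measurable_mono monoI) (simp add: Phi_le_iff)

lemma integrable_N01_bounded:
  fixes f :: "real \<Rightarrow> real"
  assumes "f \<in> borel_measurable borel" "\<And>x. \<bar>f x\<bar> \<le> B"
  shows "integrable N01 f"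
proof (rule N01.integrable_const_bound[of _ B])
  show "AE x in N01. norm (f x) \<le> B" unfolding real_norm_def by (intro AE_I2) (rule assms(2))
qed (use assms(1) in simp)

text \<open>By uniformity of \<open>Phi\<close> under \<open>N01\<close>, each of the
  \<open>q\<close> cells has mass \<open>1 / q\<close>; \<open>A r\<close> is the event that the
  cell with index \<open>r\<close> is hit.\<close>

lemma integral_N01_cells:
  fixes \<gamma> :: "int \<Rightarrow> real"
  assumes q: "q \<ge> (1::nat)"
  shows "real q * (\<integral>z. \<gamma> \<lfloor>real q * Phi z\<rfloor> \<partial>N01) = (\<Sum>r<q. \<gamma> (int r))"
proof -
  define A where "A = (\<lambda>r::nat. {z. Phi z < real (Suc r) / real q} - {z. Phi z < real r / real q})"
  have Am[measurable]: "A r \<in> sets borel" for r unfolding A_def by measurable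
  have mA: "measure N01 (A r) = 1 / real q" if "r < q" for r
  proof -
    have "measure N01 (A r) = real (Suc r) / real q - real r / real q"
      unfolding A_def
    proof (subst N01.finite_measure_Diff)
      have "real r / real q \<le> real (Suc r) / real q" by (intro divide_right_mono) auto
      thus "{z. Phi z < real r / real q} \<subseteq> {z. Phi z < real (Suc r) / real q}"
        using order.strict_trans2 by blast
    qed (use that in \<open>auto simp: measure_N01_Phi_less\<close>)
    thus ?thesis by (simp add: diff_divide_distrib[symmetric])
  qed
  have iff: "z \<in> A r \<longleftrightarrow> \<lfloor>real q * Phi z\<rfloor> = int r" for z r
  proof -
    have "Phi z < real (Suc r) / real q \<longleftrightarrow> real q * Phi z < real_of_int (int r) + 1"
      using q by (simp add: pos_less_divide_eq mult.commute add.commute)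
    moreover have "Phi z < real r / real q \<longleftrightarrow> real q * Phi z < real_of_int (int r)"
      using q by (simp add: pos_less_divide_eq mult.commute)
    ultimately show ?thesis unfolding A_def floor_eq_iff by auto
  qed
  have eq: "\<gamma> \<lfloor>real q * Phi z\<rfloor> = (\<Sum>r<q. \<gamma> (int r) * indicator (A r) z)" for z
  proof -
    define k where "k = nat \<lfloor>real q * Phi z\<rfloor>"
    have "0 < real q * Phi z" using q Phi_gt_0 by (intro mult_pos_pos) auto
    moreover have "real q * Phi z < real q * 1" using q Phi_lt_1 by (intro mult_strict_left_mono) auto
    ultimately have k: "\<lfloor>real q * Phi z\<rfloor> = int k" "k < q" unfolding k_def by (auto simp: nat_less_iff floor_less_iff)
    have "(\<Sum>r<q. \<gamma> (int r) * indicator (A r) z) = (\<Sum>r<q. if k = r then \<gamma> (int r) else 0)"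
      by (intro sum.cong) (auto simp: iff k indicator_def)
    also have "\<dots> = \<gamma> (int k)" using k by simp
    finally show ?thesis using k by simp
  qed
  have int: "integrable N01 (\<lambda>z. \<gamma> (int r) * indicator (A r) z)" for r
    by (intro integrable_mult_right integrable_N01_bounded[of _ 1] borel_measurable_indicator Am)
       (simp add: indicator_def)
  have "(\<integral>z. \<gamma> \<lfloor>real q * Phi z\<rfloor> \<partial>N01) = (\<integral>z. (\<Sum>r<q. \<gamma> (int r) * indicator (A r) z) \<partial>N01)"
    by (simp only: eq)
  also have "\<dots> = (\<Sum>r<q. \<integral>z. \<gamma> (int r) * indicator (A r) z \<partial>N01)"
    by (rule Bochner_Integration.integral_sum) (rule int)
  also have "\<dots> = (\<Sum>r<q. \<gamma> (int r) * (1 / real q))"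
  proof (intro sum.cong refl)
    fix r assume "r \<in> {..<q}"
    hence "measure N01 (A r) = 1 / real q" using mA by blast
    moreover have "(\<integral>z. indicator (A r) z \<partial>N01) = measure N01 (A r)" using Am by simp
    ultimately show "(\<integral>z. \<gamma> (int r) * indicator (A r) z \<partial>N01) = \<gamma> (int r) * (1 / real q)"
      by (subst integral_mult_right_zero) (simp only:)
  qed
  also have "\<dots> = (\<Sum>r<q. \<gamma> (int r)) * (1 / real q)" by (rule sum_distrib_right[symmetric])
  finally show ?thesis using q by simp
qed

text \<open>These are the values of \<open>d\<close> before truncation.\<close>

definition rot_quantile :: "nat \<Rightarrow> real" where "rot_quantile j = Phi_inv (frac (real j * sqrt 2))"

lemma Phi_rot_quantile: "j \<ge> 1 \<Longrightarrow> Phi (rot_quantile j) = frac (real j * sqrt 2)"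
  unfolding rot_quantile_def using frac_sqrt2_pos frac_lt_1 by (intro Phi_Phi_inv) auto

context pell
begin

text \<open>\<open>G\<close> is squeezed between step functions,
  \<open>\<gamma> (cell z) \<le> G z \<le> \<gamma> (cell z + 1)\<close>, for which both the block
  sum and the integral reduce to the sum of \<open>\<gamma>\<close> over the residues. The block sum
  lies between that sum minus 2 and plus 3, and \<open>q\<close> times the integral between it and
  it plus 1; this gives 3.\<close>

lemma block_equidistribution:
  fixes G :: "real \<Rightarrow> real"
  assumes mono: "mono G" and G0: "\<And>y. 0 \<le> G y" and G1: "\<And>y. G y \<le> 1" and a: "a \<ge> 1"
  shows "\<bar>(\<Sum>i<q. G (rot_quantile (a + i))) - real q * (\<integral>z. G z \<partial>N01)\<bar> \<le> 3"
proof -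
  \<comment> \<open>\<open>Phi_inv\<close> is meaningful only at interior grid points. Outside them
    the a priori bounds 0 and 1 of \<open>G\<close> keep \<open>\<gamma>\<close> monotone and the
    squeeze valid.\<close>
  define \<gamma> where "\<gamma> = (\<lambda>k. if k \<le> 0 then 0 else if k < int q then G (Phi_inv (real_of_int k / real q)) else 1)"
  define cell where "cell = (\<lambda>z. \<lfloor>real q * Phi z\<rfloor>)"
  have grid: "0 < real_of_int k / real q" "real_of_int k / real q < 1" if "0 < k" "k < int q" for k
    using that by auto
  have g0: "0 \<le> \<gamma> k" and g1: "\<gamma> k \<le> 1" for k using G0 G1 by (auto simp: \<gamma>_def)
  have gm: "mono \<gamma>"
  proof (rule monoI)
    fix k l :: int assume kl: "k \<le> l"
    show "\<gamma> k \<le> \<gamma> l"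
    proof (cases "0 < k \<and> l < int q")
      case True
      hence "Phi_inv (real_of_int k / real q) \<le> Phi_inv (real_of_int l / real q)"
        using kl grid[of k] grid[of l] by (subst Phi_inv_le_iff) (auto simp: Phi_Phi_inv divide_right_mono)
      thus ?thesis using True kl mono by (simp add: \<gamma>_def monoD)
    qed (use kl G0 G1 in \<open>auto simp: \<gamma>_def\<close>)
  qed
  have lo: "\<gamma> (cell z) \<le> G z" for z
  proof (cases "0 < cell z \<and> cell z < int q")
    case True
    have "real_of_int (cell z) / real q \<le> Phi z" using q unfolding cell_def by (simp add: field_simps)
    hence "Phi_inv (real_of_int (cell z) / real q) \<le> z" using True grid by (simp only: Phi_inv_le_iff)
    thus ?thesis using True mono by (simp add: \<gamma>_def monoD)
  next
    case False
    have "real q * Phi z < real q * 1" using q Phi_lt_1 by (intro mult_strict_left_mono) auto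
    hence "cell z < int q" by (simp add: cell_def floor_less_iff)
    thus ?thesis using False G0 by (auto simp: \<gamma>_def)
  qed
  have hi: "G z \<le> \<gamma> (cell z + 1)" for z
  proof (cases "cell z + 1 < int q")
    case True
    have c0: "0 \<le> cell z" using Phi_gt_0[of z] by (simp add: cell_def)
    have "real q * Phi z < real_of_int (cell z) + 1" unfolding cell_def by linarith
    hence "Phi z \<le> real_of_int (cell z + 1) / real q" using q by (simp add: field_simps)
    hence "z \<le> Phi_inv (real_of_int (cell z + 1) / real q)" using True c0 grid[of "cell z + 1"] by (subst le_Phi_inv_iff) auto
    thus ?thesis using True c0 mono by (simp add: \<gamma>_def monoD)
  next
    case False
    have "0 \<le> cell z" using Phi_gt_0[of z] by (simp add: cell_def)
    thus ?thesis using False G1 by (auto simp: \<gamma>_def)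
  qed
  define c where "c = (\<lambda>i. \<lfloor>real q * frac (real (a + i) * sqrt 2)\<rfloor>)"
  have cell_c: "cell (rot_quantile (a + i)) = c i" for i unfolding cell_def c_def using Phi_rot_quantile[of "a + i"] a by simp
  have Gm[measurable]: "G \<in> borel_measurable borel" using mono by (rule borel_measurable_mono)
  have int: "integrable N01 G" by (rule integrable_N01_bounded[of _ 1]) (use G0 G1 in \<open>auto simp: abs_if not_less intro: order.trans[of _ 0]\<close>)
  have intg: "integrable N01 (\<lambda>z. \<gamma> (cell z + k))" for k
    unfolding cell_def by (rule integrable_N01_bounded[of _ 1]) (use g0 g1 in auto)
  have "(\<integral>z. \<gamma> (cell z) \<partial>N01) \<le> (\<integral>z. G z \<partial>N01)" using intg[of 0] int lo by (intro integral_mono) auto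
  hence i1: "(\<Sum>r<q. \<gamma> (int r)) \<le> real q * (\<integral>z. G z \<partial>N01)"
    using integral_N01_cells[OF q, of \<gamma>] q by (simp add: cell_def flip: integral_N01_cells[OF q, of \<gamma>])
  have "(\<integral>z. G z \<partial>N01) \<le> (\<integral>z. \<gamma> (cell z + 1) \<partial>N01)" using intg[of 1] int hi by (intro integral_mono) auto
  hence "real q * (\<integral>z. G z \<partial>N01) \<le> (\<Sum>r<q. \<gamma> (int r + 1))"
    using q by (simp add: cell_def flip: integral_N01_cells[OF q, of "\<lambda>k. \<gamma> (k + 1)"])
  hence i2: "real q * (\<integral>z. G z \<partial>N01) \<le> (\<Sum>r<q. \<gamma> (int r)) + 1"
    using sum_shift_le[of \<gamma> q] g0 g1 by simp
  have "(\<Sum>i<q. G (rot_quantile (a + i))) \<le> (\<Sum>i<q. \<gamma> (c i + 1))"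
    by (intro sum_mono) (use hi cell_c in metis)
  moreover have "(\<Sum>i<q. \<gamma> (c i)) \<le> (\<Sum>i<q. G (rot_quantile (a + i)))"
    by (intro sum_mono) (use lo cell_c in metis)
  ultimately show ?thesis
    using sum_cells[OF g0 g1 gm, of c a] i1 i2 by (simp add: c_def)
qed

end

section \<open>Normal tails, the convolution identity and Gaussian averages\<close>

section \<open>Gaussian smoothing of a test function\<close>

text \<open>Exponential tilting: where \<open>\<bar>z\<bar> > L\<close>, the sum of
  \<open>exp (z - L)\<close> and \<open>exp (- z - L)\<close> is at least 1, and multiplying the
  standard density by \<open>exp z\<close> or \<open>exp (- z)\<close> gives
  \<open>exp (1 / 2)\<close> times a normal density of mean 1 or -1. The constant uses
  \<open>exp (1 / 2) \<le> 2\<close>.\<close>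

lemma std_normal_tail: "measure N01 {z. L < \<bar>z\<bar>} \<le> 4 * exp (- L)"
proof -
  let ?g = "\<lambda>z. exp (1 / 2 - L) * (normal_density 1 1 z + normal_density (-1) 1 z)"
  have A: "{z::real. L < \<bar>z\<bar>} \<in> sets borel" by measurable
  have shift: "exp (1 / 2) * normal_density c 1 z = exp (c * z) * std_normal_density z" if "c = 1 \<or> c = -1" for c z :: real
    using that by (auto simp: normal_density_def exp_add[symmetric] power2_eq_square field_simps simp flip: exp_add)
  have "(\<integral>z. indicator {z. L < \<bar>z\<bar>} z * std_normal_density z \<partial>lborel) \<le> (\<integral>z. ?g z \<partial>lborel)"
  proof (rule integral_mono)
    show "integrable lborel (\<lambda>z. indicator {z. L < \<bar>z\<bar>} z * std_normal_density z)"
      using integrable_real_mult_indicator[of "{z. L < \<bar>z\<bar>}" lborel std_normal_density] A by (simp add: mult.commute)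
    fix z :: real
    have g: "?g z = exp (z - L) * std_normal_density z + exp (- z - L) * std_normal_density z"
      using shift[of 1 z] shift[of "-1" z] by (simp add: exp_diff distrib_left add_divide_distrib)
    have n: "0 \<le> std_normal_density z" by simp
    show "indicator {z. L < \<bar>z\<bar>} z * std_normal_density z \<le> ?g z"
    proof (cases "L < \<bar>z\<bar>")
      case True
      hence "1 \<le> exp (z - L) + exp (- z - L)"
        by (cases "z \<ge> 0") (auto intro: add_increasing2 add_increasing)
      hence "1 * std_normal_density z \<le> (exp (z - L) + exp (- z - L)) * std_normal_density z"
        using n by (rule mult_right_mono)
      thus ?thesis unfolding g using True by (simp add: distrib_right)
    qed (unfold g, use n in simp)
  qed simp
  also have "\<dots> = 2 * exp (1 / 2 - L)" by simp
  also have "\<dots> = 2 * exp (1 / 2) * exp (- L)" by (simp flip: exp_add)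
  also have "\<dots> \<le> 4 * exp (- L)"
  proof -
    have "(exp (1 / 2 :: real))\<^sup>2 \<le> 2\<^sup>2" using exp_le by (simp add: power2_eq_square flip: exp_add)
    hence "exp (1 / 2 :: real) \<le> 2" by (rule power2_le_imp_le) simp
    thus ?thesis by simp
  qed
  finally show ?thesis using A by (simp add: measure_N01)
qed

lemma integrable_N01_abs: "integrable N01 (\<lambda>z. \<bar>z\<bar>)"
  using integrable_std_normal_moment_abs[of 1] by (subst integrable_density) auto

lemma expectation_N01_abs: "(\<integral>z. \<bar>z\<bar> \<partial>N01) \<le> 1"
proof -
  have "(\<integral>z. \<bar>z\<bar> \<partial>N01) = sqrt (2 / pi)"
    using integral_std_normal_moment_abs_odd[of 0] by (subst integral_density) auto
  also have "\<dots> \<le> 1" using pi_gt3 by (intro real_le_lsqrt) auto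
  finally show ?thesis .
qed

lemma nn_integral_normal:
  assumes "0 < a" and [measurable]: "g \<in> borel_measurable borel"
  shows "(\<integral>\<^sup>+u. g u \<partial>density lborel (normal_density 0 a)) = (\<integral>\<^sup>+z. g (a * z) \<partial>N01)"
proof -
  have "distributed N01 lborel (\<lambda>z. z) std_normal_density"
    by (simp add: distributed_def distr_id2 sets_eq_imp_space_eq)
  from N01.normal_density_affine[OF this, of a 0] assms(1)
  have "distributed N01 lborel (\<lambda>z. a * z) (normal_density 0 a)" by simp
  hence "density lborel (normal_density 0 a) = distr N01 lborel (\<lambda>z. a * z)"
    by (rule distributed_distr_eq_density[symmetric])
  thus ?thesis by (simp add: nn_integral_distr)
qed

text \<open>A sum of independent centred normal variables is normal and the variances add. A
  vanishing coefficient gives a point mass without density and is a separate case.\<close>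

lemma nn_integral_N01_convolution:
  assumes "0 \<le> a" "0 \<le> b" and [measurable]: "g \<in> borel_measurable borel"
  shows "(\<integral>\<^sup>+z. \<integral>\<^sup>+w. g (a * z + b * w) \<partial>N01 \<partial>N01) = (\<integral>\<^sup>+z. g (sqrt (a\<^sup>2 + b\<^sup>2) * z) \<partial>N01)"
proof -
  have one: "emeasure N01 UNIV = 1" using N01.emeasure_space_1 by simp
  consider "a = 0" | "b = 0" | "0 < a" "0 < b" using assms by linarith
  thus ?thesis
  proof cases
    case 3
    let ?M = "\<lambda>s. density lborel (\<lambda>x. ennreal (normal_density 0 s x))"
    have fin: "finite_measure (?M s)" if "s > 0" for s
      using prob_space_normal_density[OF that] by (simp add: prob_space_def)
    have "(?M a \<star> ?M b) = density lborel (\<lambda>x. \<integral>\<^sup>+y. ennreal (normal_density 0 a (x - y)) * ennreal (normal_density 0 b y) \<partial>lborel)"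
      using fin 3 by (intro convolution_density) auto
    also have "(\<lambda>x. \<integral>\<^sup>+y. ennreal (normal_density 0 a (x - y)) * ennreal (normal_density 0 b y) \<partial>lborel) =
        (\<lambda>x. ennreal (normal_density 0 (sqrt (a\<^sup>2 + b\<^sup>2)) x))"
      unfolding conv_normal_density_zero_mean[OF 3, symmetric] by (simp only: ennreal_mult' normal_density_nonneg)
    finally have "?M (sqrt (a\<^sup>2 + b\<^sup>2)) = (?M a \<star> ?M b)" by (rule sym)
    hence "(\<integral>\<^sup>+u. g u \<partial>?M (sqrt (a\<^sup>2 + b\<^sup>2))) = (\<integral>\<^sup>+u. g u \<partial>(?M a \<star> ?M b))" by (rule arg_cong)
    also have "\<dots> = (\<integral>\<^sup>+u. \<integral>\<^sup>+v. g (u + v) \<partial>?M b \<partial>?M a)"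
      using fin 3 by (intro nn_integral_convolution) auto
    also have "\<dots> = (\<integral>\<^sup>+u. \<integral>\<^sup>+w. g (u + b * w) \<partial>N01 \<partial>?M a)"
      using 3 by (intro nn_integral_cong nn_integral_normal) auto
    also have "\<dots> = (\<integral>\<^sup>+z. \<integral>\<^sup>+w. g (a * z + b * w) \<partial>N01 \<partial>N01)"
      using 3 by (intro nn_integral_normal) auto
    finally have "(\<integral>\<^sup>+u. g u \<partial>?M (sqrt (a\<^sup>2 + b\<^sup>2))) = (\<integral>\<^sup>+z. \<integral>\<^sup>+w. g (a * z + b * w) \<partial>N01 \<partial>N01)" .
    moreover have "(\<integral>\<^sup>+u. g u \<partial>?M (sqrt (a\<^sup>2 + b\<^sup>2))) = (\<integral>\<^sup>+z. g (sqrt (a\<^sup>2 + b\<^sup>2) * z) \<partial>N01)"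
      using 3 by (intro nn_integral_normal) (simp_all add: add_pos_pos)
    ultimately show ?thesis by (rule subst)
  next
    case 1
    thus ?thesis using \<open>0 \<le> b\<close> by (simp add: one)
  next
    case 2
    thus ?thesis using \<open>0 \<le> a\<close> by (simp add: one)
  qed
qed

locale smooth_test =
  fixes \<psi> :: "real \<Rightarrow> real" and \<Lambda> :: real
  assumes mono: "mono \<psi>" and nonneg: "\<And>x. 0 \<le> \<psi> x" and le_1: "\<And>x. \<psi> x \<le> 1"
    and lipschitz: "\<And>x y. \<bar>\<psi> x - \<psi> y\<bar> \<le> \<Lambda> * \<bar>x - y\<bar>"
begin

text \<open>The Gaussian counterpart of \<open>perm_avg\<close>, with a centred normal variable of
  variance \<open>k\<close> for the sum over cycles. Scaling a single \<open>N01\<close> variable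
  also covers \<open>k = 0\<close> and couples different variances.\<close>

definition Psi :: "nat \<Rightarrow> real \<Rightarrow> real" where
  "Psi k x = (\<integral>z. \<psi> (x + sqrt (real k) * z) \<partial>N01)"

lemma \<Lambda>_nonneg: "0 \<le> \<Lambda>"
  using lipschitz[of 0 1] by simp

lemma measurable_\<psi>[measurable]: "\<psi> \<in> borel_measurable borel"
  using mono by (rule borel_measurable_mono)

lemma integrable_\<psi>: "integrable N01 (\<lambda>z. \<psi> (x + c * z))"
  by (rule integrable_N01_bounded[of _ 1]) (use nonneg le_1 in auto)

lemma Psi_0: "Psi 0 x = \<psi> x"
  unfolding Psi_def using N01.prob_space by simp

lemma mono_Psi: "mono (Psi k)"
  unfolding Psi_def by (intro monoI integral_mono integrable_\<psi> monoD[OF mono]) auto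

lemma measurable_Psi[measurable]: "Psi k \<in> borel_measurable borel"
  using mono_Psi by (rule borel_measurable_mono)

lemma Psi_nonneg: "0 \<le> Psi k x"
  unfolding Psi_def by (intro integral_nonneg_AE) (auto simp: nonneg)

lemma Psi_le_1: "Psi k x \<le> 1"
  unfolding Psi_def using integral_mono[OF integrable_\<psi>, of "\<lambda>_. 1"] le_1 N01.prob_space by simp

text \<open>Both averages use the same variable \<open>z\<close>, so the Lipschitz bound applies
  under the integral, and the mean of \<open>\<bar>z\<bar>\<close> is at most 1.\<close>

lemma Psi_perturb: "\<bar>Psi k x - Psi l y\<bar> \<le> \<Lambda> * (\<bar>x - y\<bar> + \<bar>sqrt (real k) - sqrt (real l)\<bar>)"
proof -
  let ?s = "\<bar>sqrt (real k) - sqrt (real l)\<bar>"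
  have "\<bar>Psi k x - Psi l y\<bar> = \<bar>\<integral>z. \<psi> (x + sqrt (real k) * z) - \<psi> (y + sqrt (real l) * z) \<partial>N01\<bar>"
    unfolding Psi_def by (subst Bochner_Integration.integral_diff) (auto intro: integrable_\<psi>)
  also have "\<dots> \<le> (\<integral>z. \<bar>\<psi> (x + sqrt (real k) * z) - \<psi> (y + sqrt (real l) * z)\<bar> \<partial>N01)"
    by (rule integral_abs_bound)
  also have "\<dots> \<le> (\<integral>z. \<Lambda> * \<bar>x - y\<bar> + \<Lambda> * ?s * \<bar>z\<bar> \<partial>N01)"
  proof (rule integral_mono)
    fix z :: real
    have "\<bar>(x + sqrt (real k) * z) - (y + sqrt (real l) * z)\<bar> = \<bar>(x - y) + (sqrt (real k) - sqrt (real l)) * z\<bar>"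
      by (simp add: algebra_simps)
    also have "\<dots> \<le> \<bar>x - y\<bar> + ?s * \<bar>z\<bar>" by (metis abs_mult abs_triangle_ineq)
    finally have "\<Lambda> * \<bar>(x + sqrt (real k) * z) - (y + sqrt (real l) * z)\<bar> \<le> \<Lambda> * (\<bar>x - y\<bar> + ?s * \<bar>z\<bar>)"
      using \<Lambda>_nonneg by (rule mult_left_mono)
    thus "\<bar>\<psi> (x + sqrt (real k) * z) - \<psi> (y + sqrt (real l) * z)\<bar> \<le> \<Lambda> * \<bar>x - y\<bar> + \<Lambda> * ?s * \<bar>z\<bar>"
      using lipschitz[of "x + sqrt (real k) * z" "y + sqrt (real l) * z"] by (simp add: distrib_left mult.assoc)
  qed (auto intro!: integrable_\<psi> integrable_N01_abs Bochner_Integration.integrable_diff integrable_mult_right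
      Bochner_Integration.integrable_add integrable_abs)
  also have "\<dots> = \<Lambda> * \<bar>x - y\<bar> + \<Lambda> * ?s * (\<integral>z. \<bar>z\<bar> \<partial>N01)"
    using integrable_N01_abs N01.prob_space by (subst Bochner_Integration.integral_add) auto
  also have "\<dots> \<le> \<Lambda> * \<bar>x - y\<bar> + \<Lambda> * ?s * 1"
    using expectation_N01_abs \<Lambda>_nonneg by (intro add_left_mono mult_left_mono) auto
  finally show ?thesis by (simp add: distrib_left)
qed

text \<open>Additivity of variances, carried over from non-negative integrals. With
  \<open>l = j\<close> and \<open>k = m - j\<close> it is the exact Gaussian form of the permutation
  recursion.\<close>

lemma Psi_convolution: "(\<integral>z. Psi k (x + sqrt (real l) * z) \<partial>N01) = Psi (l + k) x"
proof -
  have "ennreal (\<integral>z. Psi k (x + sqrt (real l) * z) \<partial>N01) = (\<integral>\<^sup>+z. ennreal (Psi k (x + sqrt (real l) * z)) \<partial>N01)"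
    by (intro nn_integral_eq_integral[symmetric] integrable_N01_bounded[of _ 1])
       (auto simp: Psi_nonneg Psi_le_1)
  also have "\<dots> = (\<integral>\<^sup>+z. \<integral>\<^sup>+w. ennreal (\<psi> (x + (sqrt (real l) * z + sqrt (real k) * w))) \<partial>N01 \<partial>N01)"
    unfolding Psi_def
    by (intro nn_integral_cong, subst nn_integral_eq_integral[OF integrable_\<psi>, symmetric]) (auto simp: nonneg add.assoc)
  also have "\<dots> = (\<integral>\<^sup>+z. ennreal (\<psi> (x + sqrt ((sqrt (real l))\<^sup>2 + (sqrt (real k))\<^sup>2) * z)) \<partial>N01)"
    by (rule nn_integral_N01_convolution[of _ _ "\<lambda>u. ennreal (\<psi> (x + u))"]) auto
  also have "\<dots> = ennreal (Psi (l + k) x)"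
    unfolding Psi_def by (subst nn_integral_eq_integral[OF integrable_\<psi>]) (auto simp: nonneg)
  finally show ?thesis
    using Psi_nonneg by (subst (asm) ennreal_inj) (auto intro!: integral_nonneg_AE)
qed

end

section \<open>Comparison of the permutation recursion with the Gaussian one, block by block\<close>

section \<open>The error in the recursion\<close>

lemma abs_d_le: "j \<ge> 1 \<Longrightarrow> \<bar>d j\<bar> \<le> ln (real j)"
  by (auto simp: d_def)

lemma d_eq_rot_quantile: "\<not> ln (real j) < \<bar>rot_quantile j\<bar> \<Longrightarrow> d j = rot_quantile j"
  by (simp add: d_def rot_quantile_def)

lemma sqrt_nat_diff: "l \<le> k \<Longrightarrow> k \<le> l + r \<Longrightarrow> \<bar>sqrt (real k) - sqrt (real l)\<bar> \<le> sqrt (real r)"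
proof -
  assume *: "l \<le> k" "k \<le> l + r"
  have "sqrt (real k) \<le> sqrt (real l + real r)" using * by simp
  also have "\<dots> \<le> sqrt (real l) + sqrt (real r)" by (rule sqrt_add_le_add_sqrt) auto
  finally show ?thesis using * by simp
qed

text \<open>The two-sided condition is split into monotone one-sided ones, each equidistributed up
  to 3. The tail bound gives Gaussian mass at most \<open>4 / q\<close>, hence
  \<open>4 + 3 + 3\<close>.\<close>

lemma (in pell) large_quantile_count:
  assumes a: "a \<ge> 1"
  shows "(\<Sum>i<q. if ln (real q) < \<bar>rot_quantile (a + i)\<bar> then 1 else 0 :: real) \<le> 10"
proof -
  let ?L = "ln (real q)"
  let ?G1 = "\<lambda>y. if ?L < y then 1 else 0 :: real" and ?G2 = "\<lambda>y. if - ?L \<le> y then 1 else 0 :: real"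
  have L: "?L \<ge> 0" using q by simp
  have eq: "(if ?L < \<bar>y\<bar> then 1 else 0 :: real) = ?G1 y + (1 - ?G2 y)" for y using L by auto
  have m1: "mono ?G1" and m2: "mono ?G2" by (auto intro!: monoI)
  have int: "integrable N01 ?G1" "integrable N01 ?G2"
    by (auto intro!: integrable_N01_bounded[of _ 1])
  have "(\<integral>z. ?G1 z \<partial>N01) + (1 - (\<integral>z. ?G2 z \<partial>N01)) = (\<integral>z. ?G1 z + (1 - ?G2 z) \<partial>N01)"
    using int N01.prob_space by (subst Bochner_Integration.integral_add Bochner_Integration.integral_diff; simp)+
  also have "\<dots> = (\<integral>z. indicator {z. ?L < \<bar>z\<bar>} z \<partial>N01)"
    unfolding eq[symmetric] by (intro Bochner_Integration.integral_cong) (auto simp: indicator_def)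
  also have "\<dots> = measure N01 {z. ?L < \<bar>z\<bar>}" by simp
  also have "\<dots> \<le> 4 * exp (- ?L)" by (rule std_normal_tail)
  also have "\<dots> = 4 / real q" using q by (simp add: exp_minus field_simps)
  finally have "real q * ((\<integral>z. ?G1 z \<partial>N01) + (1 - (\<integral>z. ?G2 z \<partial>N01))) \<le> real q * (4 / real q)"
    by (rule mult_left_mono) simp
  hence "real q * (\<integral>z. ?G1 z \<partial>N01) + (real q - real q * (\<integral>z. ?G2 z \<partial>N01)) \<le> 4"
    using q by (simp add: algebra_simps)
  moreover have "\<bar>(\<Sum>i<q. ?G1 (rot_quantile (a + i))) - real q * (\<integral>z. ?G1 z \<partial>N01)\<bar> \<le> 3"
    by (rule block_equidistribution[OF m1 _ _ a]) auto
  moreover have "\<bar>(\<Sum>i<q. ?G2 (rot_quantile (a + i))) - real q * (\<integral>z. ?G2 z \<partial>N01)\<bar> \<le> 3"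
    by (rule block_equidistribution[OF m2 _ _ a]) auto
  moreover have "(\<Sum>i<q. if ?L < \<bar>rot_quantile (a + i)\<bar> then 1 else 0 :: real) =
      (\<Sum>i<q. ?G1 (rot_quantile (a + i))) + (real q - (\<Sum>i<q. ?G2 (rot_quantile (a + i))))"
    unfolding eq by (simp only: sum.distrib sum_subtractf) simp
  ultimately show ?thesis by linarith
qed

locale smooth_pell = smooth_test \<psi> \<Lambda> + pell p q for \<psi> \<Lambda> p q +
  fixes n :: nat
begin

definition step_err :: "nat \<Rightarrow> real \<Rightarrow> nat \<Rightarrow> real" where
  "step_err m x j = Psi (m - j) (x + d j * sqrt (real j)) - Psi m x"

text \<open>No cancellation between indices is used, so this is effective only for small
  \<open>j\<close>; it serves the initial stretch below \<open>2 * q\<close>.\<close>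

lemma step_err_le:
  assumes "1 \<le> j" "j \<le> m" "m \<le> n"
  shows "\<bar>step_err m x j\<bar> \<le> \<Lambda> * (sqrt (real j) * (1 + ln (real n)))"
proof -
  have "\<bar>sqrt (real (m - j)) - sqrt (real m)\<bar> \<le> sqrt (real j)"
    using sqrt_nat_diff[of "m - j" m j] assms by (simp add: abs_minus_commute)
  moreover have "ln (real j) \<le> ln (real n)" using assms by simp
  hence "\<bar>d j\<bar> * sqrt (real j) \<le> ln (real n) * sqrt (real j)"
    using abs_d_le[OF assms(1)] by (intro mult_right_mono) auto
  ultimately have "\<bar>(x + d j * sqrt (real j)) - x\<bar> + \<bar>sqrt (real (m - j)) - sqrt (real m)\<bar> \<le> sqrt (real j) * (1 + ln (real n))"
    by (simp add: abs_mult algebra_simps)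
  thus ?thesis unfolding step_err_def
    using Psi_perturb \<Lambda>_nonneg by (meson mult_left_mono order.trans)
qed

text \<open>Within a block, \<open>sqrt j\<close> and \<open>m - j\<close> are frozen at the first
  index \<open>a\<close>, at a Lipschitz cost per term. What is left is a block sum of the monotone
  function \<open>G\<close>: equidistribution costs 3 and the truncation of \<open>d\<close> costs
  10.\<close>

lemma block_step_err:
  assumes a: "q < a" "a + q \<le> Suc m" "m \<le> n"
  shows "\<bar>\<Sum>i<q. step_err m x (a + i)\<bar> \<le> real q * (\<Lambda> * (sqrt (real q) * (1 + ln (real n)))) + 13"
proof -
  define G where "G = (\<lambda>y. Psi (m - a) (x + y * sqrt (real a)))"
  define E where "E = \<Lambda> * (sqrt (real q) * (1 + ln (real n)))"
  define T where "T = (\<lambda>i. if ln (real q) < \<bar>rot_quantile (a + i)\<bar> then 1 else 0 :: real)"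
  have G01: "0 \<le> G y" "G y \<le> 1" for y by (simp_all add: G_def Psi_nonneg Psi_le_1)
  have Gmono: "mono G" unfolding G_def by (intro monoI monoD[OF mono_Psi]) (simp add: mult_right_mono)
  \<comment> \<open>Freezing both quantities at the same \<open>a\<close> makes the variances
    \<open>a\<close> and \<open>m - a\<close> add up to exactly \<open>m\<close>.\<close>
  have "(\<integral>z. G z \<partial>N01) = Psi (a + (m - a)) x"
    unfolding G_def using Psi_convolution[of "m - a" x a] by (simp add: mult.commute)
  also have "a + (m - a) = m" using a q by simp
  finally have EG: "(\<integral>z. G z \<partial>N01) = Psi m x" .
  have pointwise: "\<bar>step_err m x (a + i) - (G (rot_quantile (a + i)) - Psi m x)\<bar> \<le> E + T i" if i: "i < q" for i
  proof -
    let ?j = "a + i"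
    have 1: "\<bar>sqrt (real (m - ?j)) - sqrt (real (m - a))\<bar> \<le> sqrt (real q)"
      using sqrt_nat_diff[of "m - ?j" "m - a" q] i by (simp add: abs_minus_commute)
    have 2: "\<bar>sqrt (real ?j) - sqrt (real a)\<bar> \<le> sqrt (real q)"
      using sqrt_nat_diff[of a ?j q] i by simp
    have "ln (real ?j) \<le> ln (real n)" using a i by (subst ln_le_cancel_iff) auto
    hence 3: "\<bar>d ?j\<bar> \<le> ln (real n)" using abs_d_le[of ?j] a by linarith
    have "\<bar>(x + d ?j * sqrt (real ?j)) - (x + d ?j * sqrt (real a))\<bar> = \<bar>d ?j\<bar> * \<bar>sqrt (real ?j) - sqrt (real a)\<bar>"
      by (simp add: right_diff_distrib[symmetric] abs_mult)
    also have "\<dots> \<le> ln (real n) * sqrt (real q)" using 2 3 by (intro mult_mono) auto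
    finally have "\<bar>(x + d ?j * sqrt (real ?j)) - (x + d ?j * sqrt (real a))\<bar> + \<bar>sqrt (real (m - ?j)) - sqrt (real (m - a))\<bar>
       \<le> sqrt (real q) * (1 + ln (real n))" using 1 by (simp add: algebra_simps)
    hence "\<bar>Psi (m - ?j) (x + d ?j * sqrt (real ?j)) - G (d ?j)\<bar> \<le> E"
      unfolding E_def G_def using Psi_perturb \<Lambda>_nonneg by (meson mult_left_mono order.trans)
    moreover have "\<bar>G (d ?j) - G (rot_quantile ?j)\<bar> \<le> T i"
    proof (cases "ln (real q) < \<bar>rot_quantile ?j\<bar>")
      case True
      thus ?thesis using G01[of "d ?j"] G01[of "rot_quantile ?j"] by (auto simp: T_def abs_if)
    next
      case False
      \<comment> \<open>As the block starts beyond \<open>q\<close>, a quantile of modulus at most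
        \<open>ln q\<close> is not truncated at any of its indices.\<close>
      have "ln (real q) \<le> ln (real ?j)" using a q by (subst ln_le_cancel_iff) auto
      hence "d ?j = rot_quantile ?j" using False by (intro d_eq_rot_quantile) auto
      thus ?thesis by (simp add: T_def)
    qed
    ultimately show ?thesis unfolding step_err_def by linarith
  qed
  have "\<bar>\<Sum>i<q. step_err m x (a + i) - (G (rot_quantile (a + i)) - Psi m x)\<bar> \<le> (\<Sum>i<q. E + T i)"
    using pointwise by (intro order.trans[OF sum_abs] sum_mono) auto
  also have "\<dots> = real q * E + (\<Sum>i<q. T i)" by (simp add: sum.distrib)
  finally have "\<bar>\<Sum>i<q. step_err m x (a + i) - (G (rot_quantile (a + i)) - Psi m x)\<bar> \<le> real q * E + 10"
    using large_quantile_count[of a] a unfolding T_def by simp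
  moreover have "(\<Sum>i<q. step_err m x (a + i) - (G (rot_quantile (a + i)) - Psi m x)) =
     (\<Sum>i<q. step_err m x (a + i)) - ((\<Sum>i<q. G (rot_quantile (a + i))) - real q * Psi m x)"
    by (simp add: sum_subtractf)
  moreover have "\<bar>(\<Sum>i<q. G (rot_quantile (a + i))) - real q * Psi m x\<bar> \<le> 3"
    using block_equidistribution[OF Gmono G01, of a] a EG by simp
  ultimately show ?thesis unfolding E_def by linarith
qed

text \<open>The error per index. The factor 2 under the root accommodates the initial indices below
  \<open>2 * q\<close>, and \<open>13 / real q\<close> spreads the constant error of a block over
  its \<open>q\<close> members.\<close>

definition \<epsilon> :: real where
  "\<epsilon> = \<Lambda> * (sqrt (2 * real q) * (1 + ln (real n))) + 13 / real q"

text \<open>Blocks of length \<open>q\<close> are removed from the top as long as at least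
  \<open>2 * q\<close> indices remain; the rest is bounded term by term.\<close>

lemma sum_step_err:
  assumes "M \<le> m" "m \<le> n"
  shows "\<bar>\<Sum>j=1..M. step_err m x j\<bar> \<le> real M * \<epsilon>"
  using assms(1)
proof (induction M rule: less_induct)
  case (less M)
  show ?case
  proof (cases "M < 2 * q")
    case True
    have "\<bar>step_err m x j\<bar> \<le> \<epsilon>" if j: "j \<in> {1..M}" for j
    proof -
      have n: "1 \<le> n" using j less.prems assms(2) by auto
      have "\<Lambda> * (sqrt (real j) * (1 + ln (real n))) \<le> \<Lambda> * (sqrt (2 * real q) * (1 + ln (real n)))"
        using j True n \<Lambda>_nonneg by (intro mult_left_mono mult_right_mono) auto
      moreover have "\<bar>step_err m x j\<bar> \<le> \<Lambda> * (sqrt (real j) * (1 + ln (real n)))"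
        using j less.prems assms(2) by (intro step_err_le) auto
      ultimately show ?thesis unfolding \<epsilon>_def by (simp add: add_increasing2)
    qed
    hence "\<bar>\<Sum>j=1..M. step_err m x j\<bar> \<le> (\<Sum>j=1..M. \<epsilon>)"
      by (intro order.trans[OF sum_abs] sum_mono) auto
    thus ?thesis by simp
  next
    case False
    \<comment> \<open>The last block is \<open>{M - q + 1..M}\<close>. Since
      \<open>M \<ge> 2 * q\<close>, it starts beyond \<open>q\<close>, as the block estimate
      requires.\<close>
    define a where "a = Suc (M - q)"
    have n: "1 \<le> n" using False q less.prems assms(2) by linarith
    have split: "{1..M} = {1..M - q} \<union> {a..<a + q}" using False q by (auto simp: a_def)
    have "(\<Sum>j=1..M. step_err m x j) = (\<Sum>j=1..M - q. step_err m x j) + (\<Sum>j\<in>{a..<a + q}. step_err m x j)"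
      unfolding split by (rule sum.union_disjoint) (auto simp: a_def)
    also have "(\<Sum>j\<in>{a..<a + q}. step_err m x j) = (\<Sum>i<q. step_err m x (a + i))"
      by (rule sum.reindex_bij_witness[of _ "\<lambda>i. a + i" "\<lambda>j. j - a"]) auto
    finally have "\<bar>\<Sum>j=1..M. step_err m x j\<bar> \<le> \<bar>\<Sum>j=1..M - q. step_err m x j\<bar> + \<bar>\<Sum>i<q. step_err m x (a + i)\<bar>"
      by (simp add: abs_triangle_ineq)
    also have "\<bar>\<Sum>j=1..M - q. step_err m x j\<bar> \<le> real (M - q) * \<epsilon>"
      using less.prems False q by (intro less.IH) auto
    also have "\<bar>\<Sum>i<q. step_err m x (a + i)\<bar> \<le> real q * (\<Lambda> * (sqrt (real q) * (1 + ln (real n)))) + 13"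
      using less.prems False q assms(2) by (intro block_step_err) (auto simp: a_def)
    also have "\<dots> \<le> real q * (\<Lambda> * (sqrt (2 * real q) * (1 + ln (real n)))) + 13"
      using n \<Lambda>_nonneg by (intro add_right_mono mult_left_mono mult_right_mono) auto
    also have "\<dots> = real q * \<epsilon>" using q by (simp add: \<epsilon>_def distrib_left)
    finally have "\<bar>\<Sum>j=1..M. step_err m x j\<bar> \<le> real (M - q) * \<epsilon> + real q * \<epsilon>" by simp
    also have "\<dots> = real M * \<epsilon>" using False by (simp add: of_nat_diff algebra_simps)
    finally show ?thesis .
  qed
qed

lemma sum_harm: "(\<Sum>k<m. harm k :: real) = real m * harm m - real m"
proof (induction m)
  case (Suc m)
  have "real (Suc m) * harm (Suc m) = real (Suc m) * harm m + 1"
    by (simp only: harm_Suc distrib_left) simp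
  thus ?case using Suc.IH by (simp add: algebra_simps)
qed simp

text \<open>Inserting \<open>Psi (m - j)\<close> splits the difference into earlier errors and step
  errors. By \<open>sum_harm\<close> the earlier errors average to at most
  \<open>(harm m - 1) * \<epsilon>\<close>, and the step errors add at most
  \<open>\<epsilon>\<close>.\<close>

lemma perm_avg_Psi:
  assumes "m \<le> n"
  shows "\<bar>perm_avg (\<lambda>j. d j * sqrt (real j)) \<psi> m x - Psi m x\<bar> \<le> harm m * \<epsilon>"
  using assms
proof (induction m arbitrary: x rule: less_induct)
  case (less m)
  let ?w = "\<lambda>j. d j * sqrt (real j)"
  show ?case
  proof (cases "m = 0")
    case True
    thus ?thesis by (simp add: Psi_0 harm_def)
  next
    case False
    hence m: "m \<ge> 1" by simp
    have "real m * (perm_avg ?w \<psi> m x - Psi m x) = (\<Sum>j=1..m. perm_avg ?w \<psi> (m - j) (x + ?w j) - Psi m x)"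
      using m by (simp add: perm_avg_rec[OF m] right_diff_distrib sum_subtractf)
    also have "\<dots> = (\<Sum>j=1..m. perm_avg ?w \<psi> (m - j) (x + ?w j) - Psi (m - j) (x + ?w j)) + (\<Sum>j=1..m. step_err m x j)"
      unfolding step_err_def by (subst sum.distrib[symmetric]) simp
    finally have "real m * \<bar>perm_avg ?w \<psi> m x - Psi m x\<bar> =
      \<bar>(\<Sum>j=1..m. perm_avg ?w \<psi> (m - j) (x + ?w j) - Psi (m - j) (x + ?w j)) + (\<Sum>j=1..m. step_err m x j)\<bar>"
      by (metis abs_mult abs_of_nat)
    also have "\<dots> \<le> (\<Sum>j=1..m. \<bar>perm_avg ?w \<psi> (m - j) (x + ?w j) - Psi (m - j) (x + ?w j)\<bar>) + real m * \<epsilon>"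
      using sum_step_err[of m m x] less.prems by (intro order.trans[OF abs_triangle_ineq] add_mono sum_abs) auto
    also have "(\<Sum>j=1..m. \<bar>perm_avg ?w \<psi> (m - j) (x + ?w j) - Psi (m - j) (x + ?w j)\<bar>) \<le> (\<Sum>j=1..m. harm (m - j) * \<epsilon>)"
      using less.prems by (intro sum_mono less.IH) auto
    also have "\<dots> = (\<Sum>k<m. harm k * \<epsilon>)"
      by (rule sum.reindex_bij_witness[of _ "\<lambda>k. m - k" "\<lambda>j. m - j"]) auto
    also have "\<dots> = (real m * harm m - real m) * \<epsilon>" by (simp only: sum_distrib_right[symmetric] sum_harm)
    finally have "real m * \<bar>perm_avg ?w \<psi> m x - Psi m x\<bar> \<le> real m * (harm m * \<epsilon>)"
      by (simp add: algebra_simps)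
    thus ?thesis using m by simp
  qed
qed

end

section \<open>From Lipschitz test functions to the uniform distance, and the choice of
  parameters\<close>

section \<open>The rate of convergence\<close>

text \<open>Multiplying by \<open>sqrt n\<close> removes the dependence of the weights on
  \<open>n\<close>, so that one weight function serves every stage of the recursion; the cycles are
  then grouped by length.\<close>

lemma h_eq_sum_cycles:
  assumes n: "n \<ge> 1"
  shows "sqrt (real n) * h n \<sigma> = (\<Sum>C\<in>cycles_in {1..n} \<sigma>. d (card C) * sqrt (real (card C)))"
proof -
  let ?w = "\<lambda>j. d j * sqrt (real j)"
  have "sqrt (real n) * h n \<sigma> = (\<Sum>j=1..n. real (cycle_count n j \<sigma>) * ?w j)"
    unfolding h_def h_hat_def sum_distrib_left using n
    by (intro sum.cong) (simp_all add: real_sqrt_divide)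
  also have "\<dots> = (\<Sum>j=1..n. \<Sum>C\<in>{C \<in> cycles_in {1..n} \<sigma>. card C = j}. ?w (card C))"
  proof (intro sum.cong refl)
    fix j
    have "{C. C \<subseteq> {1..n} \<and> cyclic_on \<sigma> C \<and> card C = j} = {C \<in> cycles_in {1..n} \<sigma>. card C = j}"
      by (auto simp: cycles_in_def)
    thus "real (cycle_count n j \<sigma>) * ?w j = (\<Sum>C\<in>{C \<in> cycles_in {1..n} \<sigma>. card C = j}. ?w (card C))"
      by (simp add: cycle_count_def)
  qed
  also have "\<dots> = (\<Sum>C\<in>cycles_in {1..n} \<sigma>. ?w (card C))"
  proof (rule sum.group)
    show "card ` cycles_in {1..n} \<sigma> \<subseteq> {1..n}"
    proof (clarify)
      fix C assume "C \<in> cycles_in {1..n} \<sigma>"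
      hence C: "C \<subseteq> {1..n}" "C \<noteq> {}" by (auto simp: cycles_in_def cyclic_on_def)
      hence "finite C" by (meson finite_atLeastAtMost finite_subset)
      thus "card C \<in> {1..n}" using C card_mono[of "{1..n}" C] by (auto simp: Suc_le_eq card_gt_0_iff)
    qed
  qed (simp_all add: finite_cycles_in)
  finally show ?thesis .
qed

lemma finite_Sym: "finite (Sym n)"
  by (simp add: Sym_def finite_permutations)

lemma Sym_nonempty: "Sym n \<noteq> {}"
  using permutes_id[of "{1..n}"] unfolding Sym_def by blast

lemma expectation_\<nu>:
  fixes g :: "(nat \<Rightarrow> nat) \<Rightarrow> real"
  shows "measure_pmf.expectation (\<nu> n) g = (\<Sum>\<sigma> | \<sigma> permutes {1..n}. g \<sigma>) / fact n"
proof -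
  have "card (Sym n) = fact n" by (simp add: Sym_def card_permutations)
  thus ?thesis unfolding \<nu>_def integral_pmf_of_set[OF Sym_nonempty finite_Sym] by (simp add: Sym_def)
qed

lemma expectation_perm_avg:
  assumes "n \<ge> 1"
  shows "measure_pmf.expectation (\<nu> n) (\<lambda>\<sigma>. \<psi> (x + sqrt (real n) * h n \<sigma>)) =
    perm_avg (\<lambda>j. d j * sqrt (real j)) \<psi> n x"
  unfolding expectation_\<nu> h_eq_sum_cycles[OF assms]
  using sum_permutes_perm_avg[of "{1..n}" \<psi> x "\<lambda>j. d j * sqrt (real j)"] by simp

definition ramp :: "real \<Rightarrow> real \<Rightarrow> real" where
  "ramp s y = max 0 (min 1 (y / s))"

lemma smooth_test_ramp:
  assumes s: "s > 0"
  shows "smooth_test (ramp s) (1 / s)"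
proof
  show "mono (ramp s)" unfolding ramp_def using s
    by (intro monoI max.mono min.mono divide_right_mono) auto
  fix x y
  have "\<bar>ramp s x - ramp s y\<bar> \<le> \<bar>x / s - y / s\<bar>" unfolding ramp_def by linarith
  also have "\<dots> = 1 / s * \<bar>x - y\<bar>" using s by (simp add: diff_divide_distrib[symmetric])
  finally show "\<bar>ramp s x - ramp s y\<bar> \<le> 1 / s * \<bar>x - y\<bar>" .
qed (auto simp: ramp_def)

lemma ramp_eq_0: "s > 0 \<Longrightarrow> y \<le> 0 \<Longrightarrow> ramp s y = 0"
  by (simp add: ramp_def divide_nonpos_pos)

lemma ramp_eq_1: "s > 0 \<Longrightarrow> s \<le> y \<Longrightarrow> ramp s y = 1"
  by (simp add: ramp_def)

context pell
begin

text \<open>Ramps of width \<open>s\<close> bracket the indicator of a half line. On the Gaussian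
  side, of scale \<open>sqrt n\<close>, this width moves the argument of \<open>Phi\<close> by
  \<open>\<eta>\<close>, which costs at most \<open>\<eta>\<close> as \<open>Phi\<close> is
  Lipschitz with constant 1.\<close>

lemma kolmogorov_bound:
  assumes n: "n \<ge> 1" and \<eta>: "\<eta> > 0"
  shows "\<bar>F n x - Phi x\<bar> \<le> \<eta> + harm n * (1 / (\<eta> * sqrt (real n)) * (sqrt (2 * real q) * (1 + ln (real n))) + 13 / real q)"
proof -
  define s where "s = \<eta> * sqrt (real n)"
  have s: "s > 0" using n \<eta> by (simp add: s_def)
  interpret smooth_test "ramp s" "1 / s" using s by (rule smooth_test_ramp)
  interpret smooth_pell "ramp s" "1 / s" p q n ..
  define A where "A = harm n * \<epsilon>"
  define t where "t = x * sqrt (real n)"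
  let ?E = "\<lambda>y. perm_avg (\<lambda>j. d j * sqrt (real j)) (ramp s) n y"
  have err: "\<bar>?E y - Psi n y\<bar> \<le> A" for y unfolding A_def by (rule perm_avg_Psi) simp
  have E: "?E y = measure_pmf.expectation (\<nu> n) (\<lambda>\<sigma>. ramp s (y + sqrt (real n) * h n \<sigma>))" for y
    using expectation_perm_avg[OF n] by simp
  have less_t: "h n \<sigma> < x \<longleftrightarrow> sqrt (real n) * h n \<sigma> < t" for \<sigma>
    using n by (simp add: t_def mult.commute)
  have fin: "finite (set_pmf (\<nu> n))"
    unfolding \<nu>_def by (simp add: finite_Sym Sym_nonempty)
  have int: "integrable (measure_pmf (\<nu> n)) g" for g :: "_ \<Rightarrow> real"
    using fin by (rule integrable_measure_pmf_finite)
  have F: "F n x = measure_pmf.expectation (\<nu> n) (\<lambda>\<sigma>. indicator {\<sigma>. h n \<sigma> < x} \<sigma>)"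
    by (simp add: F_def)
  have E1: "1 - ?E y = measure_pmf.expectation (\<nu> n) (\<lambda>\<sigma>. 1 - ramp s (y + sqrt (real n) * h n \<sigma>))" for y
    unfolding E using int by simp
  have P1: "1 - Psi n y = (\<integral>z. 1 - ramp s (y + sqrt (real n) * z) \<partial>N01)" for y
    unfolding Psi_def using integrable_\<psi> N01.prob_space by simp
  have intP: "integrable N01 (\<lambda>z. 1 - ramp s (y + sqrt (real n) * z))" for y
    using integrable_\<psi> by simp
  have Phi: "Phi u = (\<integral>z. indicator {..u} z \<partial>N01)" for u by (simp add: Phi_def cdf_def)
  have intI: "integrable N01 (indicator {..u} :: real \<Rightarrow> real)" for u
    by (rule integrable_N01_bounded[of _ 1]) (auto simp: indicator_def)
  \<comment> \<open>Shifting by \<open>- t\<close> starts the ramp at \<open>t\<close> and bounds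
    \<open>F\<close> from above; shifting by \<open>s - t\<close> ends it at \<open>t\<close> and
    bounds \<open>F\<close> from below.\<close>
  have "F n x \<le> 1 - ?E (- t)"
    unfolding E1 F using s le_1
    by (intro integral_mono int) (auto simp: less_t indicator_def ramp_eq_0)
  moreover have "1 - ?E (s - t) \<le> F n x"
    unfolding E1 F using s nonneg
    by (intro integral_mono int) (auto simp: less_t indicator_def ramp_eq_1)
  moreover have "1 - Psi n (- t) \<le> Phi (x + \<eta>)"
    unfolding P1 Phi
  proof (intro integral_mono intP intI)
    fix z
    show "1 - ramp s (- t + sqrt (real n) * z) \<le> indicator {..x + \<eta>} z"
    proof (cases "z \<le> x + \<eta>")
      case False
      hence "sqrt (real n) * (x + \<eta>) \<le> sqrt (real n) * z" by (intro mult_left_mono) auto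
      thus ?thesis using s by (simp add: ramp_eq_1 t_def s_def algebra_simps)
    qed (simp add: nonneg)
  qed
  moreover have "Phi (x - \<eta>) \<le> 1 - Psi n (s - t)"
    unfolding P1 Phi
  proof (intro integral_mono intP intI)
    fix z
    show "indicator {..x - \<eta>} z \<le> 1 - ramp s (s - t + sqrt (real n) * z)"
    proof (cases "z \<le> x - \<eta>")
      case True
      hence "sqrt (real n) * z \<le> sqrt (real n) * (x - \<eta>)" by (intro mult_left_mono) auto
      thus ?thesis using s by (simp add: ramp_eq_0 t_def s_def algebra_simps)
    qed (simp add: le_1)
  qed
  ultimately have "\<bar>F n x - Phi x\<bar> \<le> \<eta> + A"
    using err[of "- t"] err[of "s - t"] Phi_lipschitz[of "x + \<eta>" x] Phi_lipschitz[of "x - \<eta>" x] \<eta> by linarith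
  hence "\<bar>F n x - Phi x\<bar> \<le> \<eta> + harm n * (1 / s * (sqrt (2 * real q) * (1 + ln (real n))) + 13 / real q)"
    unfolding A_def \<epsilon>_def .
  thus ?thesis unfolding s_def .
qed

end

lemma harm_le_ln: "n \<ge> 1 \<Longrightarrow> harm n \<le> 1 + ln (real n)"
proof -
  assume "n \<ge> 1"
  hence "harm (Suc (n - 1)) - ln (real (Suc (n - 1))) \<le> harm (Suc 0) - ln (real (Suc 0))"
    by (intro decseqD[OF decseq_harm_diff_ln]) simp
  thus ?thesis using \<open>n \<ge> 1\<close> by (simp add: harm_def)
qed

text \<open>This is \<open>ln y \<le> y - 1\<close> at \<open>y = n powr (1 / 32)\<close>. Two such
  logarithmic factors will cost \<open>n powr (1 / 16)\<close>.\<close>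

lemma ln_le_powr:
  assumes "n \<ge> (1::nat)"
  shows "1 + ln (real n) \<le> 33 * real n powr (1 / 32)"
proof -
  have "ln (real n powr (1 / 32)) \<le> real n powr (1 / 32) - 1" using assms by (intro ln_le_minus_one) simp
  moreover have "1 \<le> real n powr (1 / 32)" using assms by (intro ge_one_powr_ge_zero) auto
  ultimately show ?thesis using assms by (simp add: ln_powr)
qed

theorem theorem14:
  shows "\<exists>c::real. c > 0 \<and>
    (\<exists>K::real. \<forall>n::nat. n \<ge> 1 \<longrightarrow>
       (SUP x::real. \<bar>F n x - Phi x\<bar>) \<le> K * (1 / real n powr c))"
proof (intro exI conjI allI impI)
  \<comment> \<open>The exponent is \<open>1 / 8 - 2 / 32\<close>: the rate of the smoothing less
    the cost of two logarithmic factors.\<close>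
  show "(1 / 16 :: real) > 0" by simp
  fix n :: nat assume n: "n \<ge> 1"
  define r where "r = real n"
  have r: "r \<ge> 1" using n by (simp add: r_def)
  \<comment> \<open>The Pell denominator then lies between \<open>sqrt r / 3\<close> and
    \<open>sqrt r\<close>, so \<open>sqrt (2 * q)\<close> is of order at most
    \<open>r powr (1 / 4)\<close> and \<open>13 / q\<close> of order at most
    \<open>r powr (- 1 / 2)\<close>.\<close>
  define N where "N = nat \<lfloor>sqrt r\<rfloor>"
  have sr: "1 \<le> sqrt r" using r by simp
  have N: "1 \<le> N" "real N \<le> sqrt r" "sqrt r < real N + 1"
    using sr by (auto simp: N_def le_nat_iff)
  obtain p q where pq: "q \<ge> 1" "q \<le> N" "N < 3 * q" "\<bar>(int p)\<^sup>2 - 2 * (int q)\<^sup>2\<bar> = 1"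
    using pell_exists[OF N(1)] by auto
  interpret pell p q using pq by unfold_locales
  have q1: "real q \<le> sqrt r" using pq(2) N(2) by linarith
  have q2: "sqrt r \<le> 3 * real q"
  proof -
    have "real N + 1 \<le> real (3 * q)" using pq(3) by linarith
    thus ?thesis using N(3) by simp
  qed
  \<comment> \<open>This balances the smoothing cost \<open>\<eta>\<close> against the recursion
    error, of order \<open>r powr (- 1 / 4) / \<eta>\<close> up to logarithms.\<close>
  define \<eta> where "\<eta> = r powr (- 1 / 8)"
  have \<eta>: "\<eta> > 0" using r by (simp add: \<eta>_def)
  define l where "l = 1 + ln r"
  have l: "1 \<le> l" "l \<le> 33 * r powr (1 / 32)" using r ln_le_powr[OF n] by (auto simp: l_def r_def)
  have "sqrt (2 * real q) \<le> 2 * r powr (1 / 4)"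
  proof (rule real_le_lsqrt)
    have "2 * real q \<le> 4 * r powr (1 / 2)" using q1 r by (simp add: powr_half_sqrt)
    also have "\<dots> = (2 * r powr (1 / 4))\<^sup>2" by (simp add: power2_eq_square flip: powr_add)
    finally show "2 * real q \<le> (2 * r powr (1 / 4))\<^sup>2" .
  qed simp
  hence "1 / (\<eta> * sqrt r) * (sqrt (2 * real q) * l) \<le> 1 / (\<eta> * sqrt r) * (2 * r powr (1 / 4) * l)"
    using \<eta> l r by (intro mult_left_mono mult_right_mono) auto
  also have "\<dots> = 2 * r powr (- 1 / 8) * l"
  proof -
    have "1 / (\<eta> * sqrt r) * r powr (1 / 4) = r powr (1 / 4) / (r powr (- 1 / 8) * r powr (1 / 2))"
      using r by (simp add: \<eta>_def powr_half_sqrt)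
    also have "\<dots> = r powr (- 1 / 8)" by (simp flip: powr_add powr_diff)
    finally show ?thesis by (simp add: mult_ac)
  qed
  finally have 1: "1 / (\<eta> * sqrt r) * (sqrt (2 * real q) * l) \<le> 2 * r powr (- 1 / 8) * l" .
  have "13 / real q = 39 / (3 * real q)" by simp
  also have "\<dots> \<le> 39 / sqrt r" using q2 sr pq(1) by (intro divide_left_mono) auto
  also have "\<dots> = 39 * r powr (- 1 / 2)"
    using powr_minus_divide[of r "1 / 2"] powr_half_sqrt[of r] r by simp
  also have "39 * r powr (- 1 / 2) \<le> 39 * r powr (- 1 / 8) * l"
  proof -
    have "r powr (- 1 / 2) * 1 \<le> r powr (- 1 / 8) * l" using r l by (intro mult_mono powr_mono) auto
    thus ?thesis by simp
  qed
  finally have 2: "13 / real q \<le> 39 * r powr (- 1 / 8) * l" .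
  have "\<bar>F n x - Phi x\<bar> \<le> 44650 * (1 / real n powr (1 / 16))" for x
  proof -
    have "\<bar>F n x - Phi x\<bar> \<le> \<eta> + harm n * (1 / (\<eta> * sqrt r) * (sqrt (2 * real q) * l) + 13 / real q)"
      using kolmogorov_bound[OF n \<eta>] by (simp add: r_def l_def)
    \<comment> \<open>The outer \<open>l\<close> bounds the harmonic number, the inner one comes
      from the truncation level, and \<open>41 = 2 + 39\<close>.\<close>
    also have "\<dots> \<le> \<eta> + l * (41 * r powr (- 1 / 8) * l)"
    proof (intro add_left_mono mult_mono)
      show "harm n \<le> l" unfolding l_def r_def using n by (rule harm_le_ln)
      show "1 / (\<eta> * sqrt r) * (sqrt (2 * real q) * l) + 13 / real q \<le> 41 * r powr (- 1 / 8) * l"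
        using 1 2 by linarith
      show "0 \<le> 1 / (\<eta> * sqrt r) * (sqrt (2 * real q) * l) + 13 / real q"
        using l \<eta> r by (intro add_nonneg_nonneg mult_nonneg_nonneg) auto
    qed (use l in simp)
    also have "l * (41 * r powr (- 1 / 8) * l) = 41 * r powr (- 1 / 8) * (l * l)" by simp
    also have "\<dots> \<le> 41 * r powr (- 1 / 8) * ((33 * r powr (1 / 32)) * (33 * r powr (1 / 32)))"
      using l by (intro mult_left_mono mult_mono) auto
    \<comment> \<open>Here \<open>44649 = 41 * 33^2\<close>; the term \<open>\<eta>\<close> then
      raises the constant by 1.\<close>
    also have "\<dots> = 44649 * r powr (- 1 / 16)"
    proof -
      have "r powr (- 1 / 8) * (r powr (1 / 32) * r powr (1 / 32)) = r powr (- 1 / 16)" by (simp flip: powr_add)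
      thus ?thesis by (simp add: mult_ac)
    qed
    also have "\<eta> \<le> r powr (- 1 / 16)" unfolding \<eta>_def using r by (intro powr_mono) auto
    also have "r powr (- 1 / 16) + 44649 * r powr (- 1 / 16) = 44650 * (1 / real n powr (1 / 16))"
      using powr_minus_divide[of r "1 / 16"] by (simp add: r_def)
    finally show ?thesis by simp
  qed
  thus "(SUP x. \<bar>F n x - Phi x\<bar>) \<le> 44650 * (1 / real n powr (1 / 16))"
    by (intro cSUP_least) auto
qed

end
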